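(* Let $R\ge 2$ be an integer, let $B\subset\mathbb{Z}$ be a finite set with $0\in B$ and $|B|=N$, and let $\mu=\mu(R,B)$ be the self-affine measure associated with $(R,B)$. Let $L\subset\mathbb{Z}$ be a finite set with $0\in L$ and let $(\alpha_l)_{l\in L}$ be complex numbers such that $\alpha_0=1$ and the matrix $$T=\frac{1}{\sqrt N}\left(e^{2\pi i R^{-1}l b}\alpha_l\right)_{l\in L,\,b\in B}$$ has orthonormal columns, i.e. $\frac1N\sum_{l\in L}|\alpha_l|^2e^{2\pi iR^{-1}l(b-b')}=\delta_{b,b'}$ for all $b,b'\in B$. For every min-set $\mathcal M$ choose a point $c(\mathcal M)\in\mathcal M$. Then the family $$\left\{\left(\prod_{j=0}^{k}\alpha_{l_j}\right)e_{l_0+Rl_1+\dots+R^kl_k+R^{k+1}c(\mathcal M)} \;:\; l_0\dots l_k\in\Omega(c(\mathcal M)),\ \mathcal M\text{ is a min-set}\right\},$$ indexed by the pairs consisting of a min-set $\mathcal M$ and a word in $\Omega(c(\mathcal M))$ (the empty word contributing the function $e_{c(\mathcal M)}$), is a Parseval frame for $L^2(\mu(R,B))$.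
   Context: The self-affine measure $\mu(R,B)$ is the unique Borel probability measure on $\mathbb{R}$ with $\mu(E)=\frac1N\sum_{b\in B}\mu(\tau_b^{-1}(E))$ for all Borel sets $E\subset\mathbb{R}$, where $\tau_b(x)=R^{-1}(x+b)$. For $\lambda\in\mathbb{R}$, $e_\lambda(x)=e^{2\pi i\lambda x}$. A family $\{e_i\}_{i\in I}$ in a Hilbert space $H$ is a Parseval frame if $\sum_{i\in I}|\langle v,e_i\rangle|^2=\|v\|^2$ for all $v\in H$. Let $m_B(x)=\frac1N\sum_{b\in B}e^{2\pi i bx}$ and, for $l\in L$, $g_l(t)=R^{-1}(t-l)$ ($t\in\mathbb{R}$). The transition $t\to g_l(t)$ (with digit $l$) is called possible if $\alpha_l m_B(g_l(t))\neq 0$. A nonempty set $\mathcal M\subset\mathbb{R}$ is invariant if for every $t\in\mathcal M$ and $l\in L$ such that $\alpha_lm_B(g_l(t))\ne0$ one has $g_l(t)\in\mathcal M$. A min-set is a finite invariant set that is minimal, i.e. contains no proper nonempty invariant subset (the trivial min-set $\{0\}$ is included). For a point $c$ in a min-set, a word $l_0\dots l_{p-1}$ ($p\ge1$) with digits in $L$ is a cycle word for $c$ if $g_{l_{p-1}}\cdots g_{l_0}(c)=c$, $g_{l_k}\cdots g_{l_0}(c)\ne c$ for $0\le k<p-1$, and all the transitions $c\to g_{l_0}(c)\to g_{l_1}g_{l_0}(c)\to\dots\to g_{l_{p-1}}\cdots g_{l_0}(c)=c$ are possible. $\Omega(c)$ is the set of all finite words (including the empty word) with digits in $L$ that do not end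 in a cycle word for $c$, i.e. that are not of the form $\omega\omega_0$ with $\omega_0$ a cycle word for $c$ and $\omega$ an arbitrary (possibly empty) word with digits in $L$. *)

theory Defs
  imports "HOL-Probability.Probability"
begin

definition affine_map :: "int \<Rightarrow> int \<Rightarrow> real \<Rightarrow> real" where
  "affine_map R b x = (x + of_int b) / of_int R"

text \<open>Exactly one measure satisfies this predicate when \<open>R \<ge> 2\<close> and \<open>B\<close> is finite and nonempty,
  so \<open>self_affine_measure R B \<mu>\<close> says that \<open>\<mu>\<close> is the self-affine measure of \<open>(R, B)\<close>.\<close>

definition self_affine_measure :: "int \<Rightarrow> int set \<Rightarrow> real measure \<Rightarrow> bool" where
  "self_affine_measure R B \<mu> \<longleftrightarrow>
     prob_space \<mu> \<and> sets \<mu> = sets borel \<and>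
     (\<forall>E\<in>sets borel. measure \<mu> E = 1 / real (card B) * (\<Sum>b\<in>B. measure \<mu> (affine_map R b -` E)))"

definition fourier_exp :: "real \<Rightarrow> real \<Rightarrow> complex" where
  "fourier_exp s x = exp (2 * complex_of_real pi * \<i> * complex_of_real s * complex_of_real x)"

text \<open>The Hilbert space \<open>L\<^sup>2(M)\<close> is represented by its square-integrable functions, not
  divided by equality almost everywhere; inner product and norm do not depend on the representative.\<close>

definition L2_space :: "'a measure \<Rightarrow> ('a \<Rightarrow> complex) set" where
  "L2_space M = {f \<in> borel_measurable M. integrable M (\<lambda>x. (cmod (f x))\<^sup>2)}"

definition L2_inner :: "'a measure \<Rightarrow> ('a \<Rightarrow> complex) \<Rightarrow> ('a \<Rightarrow> complex) \<Rightarrow> complex" where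
  "L2_inner M f g = (LINT x|M. f x * cnj (g x))"

definition L2_norm :: "'a measure \<Rightarrow> ('a \<Rightarrow> complex) \<Rightarrow> real" where
  "L2_norm M f = sqrt (LINT x|M. (cmod (f x))\<^sup>2)"

definition parseval_frame_L2 :: "'a measure \<Rightarrow> 'i set \<Rightarrow> ('i \<Rightarrow> 'a \<Rightarrow> complex) \<Rightarrow> bool" where
  "parseval_frame_L2 M I e \<longleftrightarrow>
     (\<forall>i\<in>I. e i \<in> L2_space M) \<and>
     (\<forall>v\<in>L2_space M. ((\<lambda>i. (cmod (L2_inner M v (e i)))\<^sup>2) has_sum (L2_norm M v)\<^sup>2) I)"

definition T_matrix :: "int \<Rightarrow> int set \<Rightarrow> (int \<Rightarrow> complex) \<Rightarrow> int \<Rightarrow> int \<Rightarrow> complex" where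
  "T_matrix R B \<alpha> l b =
     1 / complex_of_real (sqrt (real (card B))) *
     (exp (2 * complex_of_real pi * \<i> * of_int l * of_int b / of_int R) * \<alpha> l)"

definition orthonormal_columns ::
    "'r set \<Rightarrow> 'c set \<Rightarrow> ('r \<Rightarrow> 'c \<Rightarrow> complex) \<Rightarrow> bool" where
  "orthonormal_columns L B T \<longleftrightarrow>
     (\<forall>b\<in>B. \<forall>b'\<in>B. (\<Sum>l\<in>L. T l b * cnj (T l b')) = (if b = b' then 1 else 0))"

definition m_fun :: "int set \<Rightarrow> real \<Rightarrow> complex" where
  "m_fun B x = 1 / of_nat (card B) * (\<Sum>b\<in>B. fourier_exp (of_int b) x)"

definition g_map :: "int \<Rightarrow> int \<Rightarrow> real \<Rightarrow> real" where
  "g_map R l t = (t - of_int l) / of_int R"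

definition possible :: "int \<Rightarrow> int set \<Rightarrow> (int \<Rightarrow> complex) \<Rightarrow> real \<Rightarrow> int \<Rightarrow> bool" where
  "possible R B \<alpha> t l \<longleftrightarrow> \<alpha> l * m_fun B (g_map R l t) \<noteq> 0"

definition invariant_set ::
    "int \<Rightarrow> int set \<Rightarrow> int set \<Rightarrow> (int \<Rightarrow> complex) \<Rightarrow> real set \<Rightarrow> bool" where
  "invariant_set R B L \<alpha> M \<longleftrightarrow>
     M \<noteq> {} \<and> (\<forall>t\<in>M. \<forall>l\<in>L. possible R B \<alpha> t l \<longrightarrow> g_map R l t \<in> M)"

definition min_set ::
    "int \<Rightarrow> int set \<Rightarrow> int set \<Rightarrow> (int \<Rightarrow> complex) \<Rightarrow> real set \<Rightarrow> bool" where
  "min_set R B L \<alpha> M \<longleftrightarrow>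
     finite M \<and> invariant_set R B L \<alpha> M \<and> (\<forall>M'. M' \<subset> M \<longrightarrow> \<not> invariant_set R B L \<alpha> M')"

text \<open>\<open>g_word R [l0, l1, l2] t = g_map R l2 (g_map R l1 (g_map R l0 t))\<close>: the first letter acts first.\<close>

definition g_word :: "int \<Rightarrow> int list \<Rightarrow> real \<Rightarrow> real" where
  "g_word R w t = foldl (\<lambda>s l. g_map R l s) t w"

definition cycle_word ::
    "int \<Rightarrow> int set \<Rightarrow> int set \<Rightarrow> (int \<Rightarrow> complex) \<Rightarrow> real \<Rightarrow> int list \<Rightarrow> bool" where
  "cycle_word R B L \<alpha> c w \<longleftrightarrow>
     w \<noteq> [] \<and> set w \<subseteq> L \<and>
     g_word R w c = c \<and>
     (\<forall>k. k < length w - 1 \<longrightarrow> g_word R (take (Suc k) w) c \<noteq> c) \<and>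
     (\<forall>k < length w. possible R B \<alpha> (g_word R (take k w) c) (w ! k))"

definition Omega ::
    "int \<Rightarrow> int set \<Rightarrow> int set \<Rightarrow> (int \<Rightarrow> complex) \<Rightarrow> real \<Rightarrow> int list set" where
  "Omega R B L \<alpha> c =
     {w. set w \<subseteq> L \<and> \<not> (\<exists>u v. w = u @ v \<and> cycle_word R B L \<alpha> c v)}"

definition word_weight :: "(int \<Rightarrow> complex) \<Rightarrow> int list \<Rightarrow> complex" where
  "word_weight \<alpha> w = (\<Prod>j<length w. \<alpha> (w ! j))"

definition word_frequency :: "int \<Rightarrow> int list \<Rightarrow> real \<Rightarrow> real" where
  "word_frequency R w c =
     (\<Sum>j<length w. of_int R ^ j * of_int (w ! j)) + of_int R ^ length w * c"

end

theory Submission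
  imports Defs "HOL-Complex_Analysis.Conformal_Mappings"
begin

text \<open>Let \<open>S\<^sub>l\<^sup>*\<close> be the operator on \<open>L\<^sup>2(\<mu>)\<close> that sends \<open>f\<close> to
  \<open>x \<mapsto> \<alpha>\<^sub>l\<^sup>* N\<^sup>-\<^sup>1 \<Sum>\<^sub>b e\<^sub>l(\<tau>\<^sub>b x)\<^sup>* f(\<tau>\<^sub>b x)\<close>, where a star on a number is complex conjugation.
  Orthonormality of the columns of the matrix says that \<open>\<Sum>\<^sub>l \<parallel>S\<^sub>l\<^sup>* f\<parallel>\<^sup>2 = \<parallel>f\<parallel>\<^sup>2\<close>
  (\<open>sum_norm_sq_cuntz_adj\<close>).  Moreover \<open>S\<^sub>l\<^sup>* e\<^sub>t\<close> is a multiple of \<open>e\<^sub>s\<close> with \<open>s = g\<^sub>l(t)\<close>, with a factor of modulus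
  \<open>\<bar>\<alpha>\<^sub>l m\<^sub>B(g\<^sub>l(t))\<bar>\<close>, so the squares of these moduli sum to one over \<open>l\<close> and describe a random walk on the line.

  A point of a min-set lies on a loop, so it is rational with denominator coprime to \<open>R\<close>.  This forces
  all digits possible at a point into one residue class modulo \<open>R\<close>, and then \<open>e\<^sub>b(c) = 1\<close> for every \<open>b \<in> B\<close>
  and every point \<open>c\<close> of a min-set (\<open>min_set_dual_point\<close>).  Two consequences matter.  First, the inner product of
  \<open>f\<close> with the function of the family attached to a word \<open>w\<close> is
  \<open>\<langle>S\<^sub>w\<^sup>* f, e\<^sub>c\<rangle>\<close> (\<open>coeff_cuntz_word\<close>).  Second, the exponentials at distinct points of min-sets
  are orthogonal (\<open>min_set_orthogonal\<close>).

  Let \<open>F(f)\<close> be the frame sum \<open>\<Sum> \<bar>\<langle>S\<^sub>w\<^sup>* f, e\<^sub>c\<rangle>\<bar>\<^sup>2\<close> over all min-sets and all \<open>w \<in> \<Omega>(c)\<close>.  Continuing each word of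
  \<open>\<Omega>(c)\<close> by the paths that start at \<open>c\<close> distributes its term without overlap over pairs of a
  longer word and a point of the min-set; orthogonality then gives \<open>F(f) \<le> \<parallel>f\<parallel>\<^sup>2\<close>
  (\<open>term_sq_finite_bessel\<close>).  So the defect \<open>G(f) = \<parallel>f\<parallel>\<^sup>2 - F(f)\<close> is the square of a seminorm
  bounded by the norm.  Cycle words are prefix-free, so they carry total probability at most one, and this
  gives \<open>\<Sum>\<^sub>l F(S\<^sub>l\<^sup>* f) \<le> F(f)\<close> (\<open>energy_cuntz_adj_le\<close>).

  Hence \<open>t \<mapsto> G(e\<^sub>t)\<close> is continuous, nonnegative, subharmonic for the random walk, and zero at the chosen point
  of every min-set, in particular at \<open>0\<close>.  A positive maximum on a large interval would be attained on
  an invariant set; following the digit \<open>0\<close> from there leads towards \<open>0\<close> unless a zero of \<open>m\<^sub>B\<close> intervenes, so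
  the invariant set is finite.  It then contains a min-set, a contradiction (\<open>exp_defect_zero\<close>).
  Thus \<open>G\<close> vanishes on all exponentials, and because they span a dense subspace
  (\<open>L2_exponential_induct\<close>), it vanishes identically.\<close>

section \<open>Exponentials and square-integrable functions\<close>

lemma fourier_exp_eq_cis: "fourier_exp s x = cis (2 * pi * s * x)"
  by (simp add: fourier_exp_def cis_conv_exp mult_ac)

lemma norm_fourier_exp [simp]: "cmod (fourier_exp s x) = 1"
  by (simp add: fourier_exp_eq_cis)

lemma fourier_exp_add: "fourier_exp (s + t) x = fourier_exp s x * fourier_exp t x"
  by (simp add: fourier_exp_eq_cis cis_mult algebra_simps)

lemma fourier_exp_add_right: "fourier_exp s (x + y) = fourier_exp s x * fourier_exp s y"
  by (simp add: fourier_exp_eq_cis cis_mult algebra_simps)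

lemma fourier_exp_commute: "fourier_exp s x = fourier_exp x s"
  by (simp add: fourier_exp_eq_cis mult_ac)

lemma cnj_fourier_exp: "cnj (fourier_exp s x) = fourier_exp (- s) x"
  by (simp add: fourier_exp_eq_cis cis_cnj)

lemma fourier_exp_diff: "fourier_exp (s - t) x = fourier_exp s x * cnj (fourier_exp t x)"
  using fourier_exp_add[of s "- t" x] by (simp add: cnj_fourier_exp)

lemma fourier_exp_zero [simp]: "fourier_exp 0 x = 1" "fourier_exp s 0 = 1"
  by (simp_all add: fourier_exp_eq_cis)

lemma fourier_exp_of_int [simp]: "fourier_exp (of_int m) (of_int n) = 1"
proof -
  have "fourier_exp (of_int m) (of_int n) = cis (2 * pi * of_int (m * n))"
    by (simp add: fourier_exp_eq_cis mult_ac)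
  then show ?thesis
    by (subst (asm) cis_multiple_2pi) auto
qed

lemma continuous_on_fourier_exp [continuous_intros]:
  "continuous_on A f \<Longrightarrow> continuous_on A (\<lambda>x. fourier_exp s (f x))"
  unfolding fourier_exp_def by (intro continuous_intros)

lemma measurable_fourier_exp [measurable]: "fourier_exp s \<in> borel_measurable borel"
  using continuous_on_fourier_exp[of UNIV "\<lambda>x. x" s]
  by (intro borel_measurable_continuous_onI) (simp add: eta_contract_eq)

lemma fourier_exp_diff_le: "cmod (fourier_exp s x - fourier_exp t x) \<le> 2 * pi * \<bar>s - t\<bar> * \<bar>x\<bar>"
proof -
  have "cmod (fourier_exp s x - fourier_exp t x) = cmod (fourier_exp t x * (fourier_exp (s - t) x - 1))"
    using fourier_exp_add[of t "s - t" x] by (simp add: algebra_simps)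
  also have "\<dots> = cmod (exp (\<i> * of_real (2 * pi * (s - t) * x)) - 1)"
    by (simp add: norm_mult fourier_exp_eq_cis cis_conv_exp)
  also have "\<dots> \<le> \<bar>2 * pi * (s - t) * x\<bar>"
    using iexp_approx1[of "2 * pi * (s - t) * x" 0] by simp
  finally show ?thesis by (simp add: abs_mult)
qed

lemma norm_add_sq_le: "(cmod (a + b))\<^sup>2 \<le> 2 * (cmod a)\<^sup>2 + 2 * (cmod b)\<^sup>2"
proof -
  have "(cmod (a + b))\<^sup>2 \<le> (cmod a + cmod b)\<^sup>2"
    by (intro power_mono norm_triangle_ineq) auto
  also have "\<dots> \<le> 2 * (cmod a)\<^sup>2 + 2 * (cmod b)\<^sup>2"
    using sum_squares_bound[of "cmod a" "cmod b"] by (simp add: power2_sum)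
  finally show ?thesis .
qed

text \<open>Parallelogram identity with a parameter: an exact form of the weighted triangle inequality
  \<open>\<bar>a + b\<bar>\<^sup>2 \<le> (1 + \<epsilon>)\<bar>a\<bar>\<^sup>2 + (1 + 1/\<epsilon>)\<bar>b\<bar>\<^sup>2\<close>.  Being an identity, it passes to differences of
  quadratic forms.\<close>

lemma weighted_parallelogram:
  fixes a b :: complex
  assumes "\<epsilon> > 0"
  shows "(cmod (of_real (sqrt \<epsilon>) * a - of_real (1 / sqrt \<epsilon>) * b))\<^sup>2
    = (1 + \<epsilon>) * (cmod a)\<^sup>2 + (1 + 1 / \<epsilon>) * (cmod b)\<^sup>2 - (cmod (a + b))\<^sup>2"
proof -
  have s: "sqrt \<epsilon> * sqrt \<epsilon> = \<epsilon>" "sqrt \<epsilon> \<noteq> 0" using assms by auto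
  have *: "(sqrt \<epsilon> * x - 1 / sqrt \<epsilon> * y)\<^sup>2 = \<epsilon> * x\<^sup>2 - 2 * x * y + y\<^sup>2 / \<epsilon>" for x y
    using s assms by (simp add: power2_diff power_mult_distrib power_divide)
  have sq: "(cmod (of_real r * a - of_real q * b))\<^sup>2 = (r * Re a - q * Re b)\<^sup>2 + (r * Im a - q * Im b)\<^sup>2" for r q
    unfolding cmod_power2 by simp
  show ?thesis
    unfolding sq * unfolding cmod_power2 using assms by (simp add: algebra_simps power2_sum)
qed

locale borel_probability = prob_space \<mu> for \<mu> :: "real measure" +
  assumes sets_eq [measurable_cong]: "sets \<mu> = sets borel"
begin

abbreviation coeff :: "(real \<Rightarrow> complex) \<Rightarrow> real \<Rightarrow> complex" where
  "coeff f s \<equiv> L2_inner \<mu> f (fourier_exp s)"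

abbreviation norm_sq :: "(real \<Rightarrow> complex) \<Rightarrow> real" where
  "norm_sq f \<equiv> (LINT x|\<mu>. (cmod (f x))\<^sup>2)"

lemma space_eq [simp]: "space \<mu> = UNIV"
  using sets_eq_imp_space_eq[OF sets_eq] by simp

lemma prob_UNIV [simp]: "prob UNIV = 1"
  using prob_space by simp

lemma L2_norm_sq: "(L2_norm \<mu> f)\<^sup>2 = norm_sq f"
  unfolding L2_norm_def by (intro real_sqrt_pow2 integral_nonneg_AE) auto

lemma L2_measurable: "f \<in> L2_space \<mu> \<Longrightarrow> f \<in> borel_measurable borel"
  unfolding L2_space_def using measurable_cong_sets[OF sets_eq refl] by auto

lemma L2_integrable_sq: "f \<in> L2_space \<mu> \<Longrightarrow> integrable \<mu> (\<lambda>x. (cmod (f x))\<^sup>2)"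
  unfolding L2_space_def by auto

lemma L2_spaceI:
  "f \<in> borel_measurable borel \<Longrightarrow> integrable \<mu> (\<lambda>x. (cmod (f x))\<^sup>2) \<Longrightarrow> f \<in> L2_space \<mu>"
  unfolding L2_space_def using measurable_cong_sets[OF sets_eq refl] by auto

lemma bounded_in_L2:
  assumes [measurable]: "f \<in> borel_measurable borel" and "\<And>x. cmod (f x) \<le> C"
  shows "f \<in> L2_space \<mu>"
proof (rule L2_spaceI)
  have "cmod (f x)^2 \<le> C^2" for x using assms(2) by (intro power_mono) auto
  then show "integrable \<mu> (\<lambda>x. (cmod (f x))\<^sup>2)"
    by (intro integrable_const_bound[where B="C^2"]) auto
qed auto

lemma fourier_exp_in_L2 [simp]: "fourier_exp s \<in> L2_space \<mu>"
  by (rule bounded_in_L2[where C=1]) auto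

lemma norm_sq_fourier_exp [simp]: "norm_sq (fourier_exp s) = 1"
  by simp

lemma L2_add:
  assumes "f \<in> L2_space \<mu>" "g \<in> L2_space \<mu>"
  shows "(\<lambda>x. f x + g x) \<in> L2_space \<mu>"
proof (rule L2_spaceI)
  note [measurable] = L2_measurable[OF assms(1)] L2_measurable[OF assms(2)]
  show "(\<lambda>x. f x + g x) \<in> borel_measurable borel" by measurable
  have "integrable \<mu> (\<lambda>x. 2 * (cmod (f x))\<^sup>2 + 2 * (cmod (g x))\<^sup>2)"
    using assms by (intro Bochner_Integration.integrable_add integrable_mult_right L2_integrable_sq)
  then show "integrable \<mu> (\<lambda>x. (cmod (f x + g x))\<^sup>2)"
    by (rule Bochner_Integration.integrable_bound) (auto simp: norm_add_sq_le)
qed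

lemma L2_scale:
  assumes "f \<in> L2_space \<mu>"
  shows "(\<lambda>x. a * f x) \<in> L2_space \<mu>"
proof (rule L2_spaceI)
  note [measurable] = L2_measurable[OF assms(1)]
  show "(\<lambda>x. a * f x) \<in> borel_measurable borel" by measurable
  show "integrable \<mu> (\<lambda>x. (cmod (a * f x))\<^sup>2)"
    using L2_integrable_sq[OF assms] by (simp add: norm_mult power_mult_distrib)
qed

lemma L2_diff:
  assumes "f \<in> L2_space \<mu>" "g \<in> L2_space \<mu>"
  shows "(\<lambda>x. f x - g x) \<in> L2_space \<mu>"
  using L2_add[OF assms(1) L2_scale[OF assms(2), of "-1"]] by simp

lemma L2_sum:
  assumes "\<And>i. i \<in> I \<Longrightarrow> f i \<in> L2_space \<mu>"
  shows "(\<lambda>x. \<Sum>i\<in>I. f i x) \<in> L2_space \<mu>"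
  using assms
proof (induction I rule: infinite_finite_induct)
  case (insert i I)
  then show ?case using L2_add[of "f i" "\<lambda>x. \<Sum>i\<in>I. f i x"] by simp
qed (auto intro: bounded_in_L2[where C=0])

lemma norm_sq_scale: "norm_sq (\<lambda>x. a * f x) = (cmod a)\<^sup>2 * norm_sq f"
  by (simp add: norm_mult power_mult_distrib)

lemma L2_integrable:
  assumes "f \<in> L2_space \<mu>"
  shows "integrable \<mu> f"
proof (rule Bochner_Integration.integrable_bound)
  note [measurable] = L2_measurable[OF assms(1)]
  show "integrable \<mu> (\<lambda>x. 1 + (cmod (f x))\<^sup>2)"
    using L2_integrable_sq[OF assms] by auto
  show "f \<in> borel_measurable \<mu>" by measurable
  have "cmod (f x) \<le> 1 + (cmod (f x))\<^sup>2" for x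
  proof -
    have "2 * cmod (f x) \<le> 1 + (cmod (f x))\<^sup>2"
      using sum_squares_bound[of 1 "cmod (f x)"] by simp
    then show ?thesis using norm_ge_zero[of "f x"] by linarith
  qed
  then show "AE x in \<mu>. norm (f x) \<le> norm (1 + (cmod (f x))\<^sup>2)" by (auto simp: add_nonneg_nonneg)
qed

lemma coeff_integrable:
  assumes "f \<in> L2_space \<mu>"
  shows "integrable \<mu> (\<lambda>x. f x * cnj (fourier_exp s x))"
proof (rule Bochner_Integration.integrable_bound[OF L2_integrable[OF assms]])
  note [measurable] = L2_measurable[OF assms(1)]
  have "(\<lambda>x. f x * fourier_exp (- s) x) \<in> borel_measurable \<mu>" by measurable
  then show "(\<lambda>x. f x * cnj (fourier_exp s x)) \<in> borel_measurable \<mu>"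
    by (simp add: cnj_fourier_exp)
qed (simp add: norm_mult)

lemma coeff_add:
  "f \<in> L2_space \<mu> \<Longrightarrow> g \<in> L2_space \<mu> \<Longrightarrow> coeff (\<lambda>x. f x + g x) s = coeff f s + coeff g s"
  unfolding L2_inner_def by (simp add: distrib_right coeff_integrable)

lemma coeff_scale: "f \<in> L2_space \<mu> \<Longrightarrow> coeff (\<lambda>x. a * f x) s = a * coeff f s"
  unfolding L2_inner_def by (simp add: mult.assoc coeff_integrable)

lemma coeff_diff:
  "f \<in> L2_space \<mu> \<Longrightarrow> g \<in> L2_space \<mu> \<Longrightarrow> coeff (\<lambda>x. f x - g x) s = coeff f s - coeff g s"
  unfolding L2_inner_def by (simp add: left_diff_distrib coeff_integrable)

lemma coeff_self [simp]: "coeff (fourier_exp s) s = 1"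
  unfolding L2_inner_def by (simp add: complex_norm_square[symmetric])

text \<open>Subtracting the projection of \<open>f\<close> on one exponential lowers the squared norm by the square of that
  coefficient and, by orthogonality, leaves the other coefficients as they are.\<close>

lemma bessel:
  assumes "finite A" "f \<in> L2_space \<mu>"
    and "\<And>s t. s \<in> A \<Longrightarrow> t \<in> A \<Longrightarrow> s \<noteq> t \<Longrightarrow> coeff (fourier_exp s) t = 0"
  shows "(\<Sum>s\<in>A. (cmod (coeff f s))\<^sup>2) \<le> norm_sq f"
  using assms
proof (induction A arbitrary: f rule: finite_induct)
  case empty
  show ?case by (simp add: integral_nonneg_AE)
next
  case (insert s A)
  define a where "a = coeff f s"
  define h where "h = (\<lambda>x. f x - a * fourier_exp s x)"
  have h: "h \<in> L2_space \<mu>" unfolding h_def by (intro L2_diff insert.prems L2_scale) auto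
  have c: "coeff h t = coeff f t" if "t \<in> A" for t
    using insert.prems insert.hyps that unfolding h_def
    by (subst coeff_diff) (auto simp: L2_scale coeff_scale)
  have pt: "(cmod (h x))\<^sup>2 = (cmod (f x))\<^sup>2 - 2 * Re (cnj a * (f x * cnj (fourier_exp s x))) + (cmod a)\<^sup>2" for x
  proof -
    have *: "(cmod (u - a * e))\<^sup>2 = (cmod u)\<^sup>2 - 2 * Re (cnj a * (u * cnj e)) + (cmod a)\<^sup>2 * (cmod e)\<^sup>2"
      for u e unfolding cmod_power2 by (simp add: algebra_simps power2_eq_square)
    show ?thesis unfolding h_def * by simp
  qed
  have i: "integrable \<mu> (\<lambda>x. cnj a * (f x * cnj (fourier_exp s x)))"
    using coeff_integrable[OF insert.prems(1)] by simp
  have "norm_sq h = norm_sq f - 2 * Re (LINT x|\<mu>. cnj a * (f x * cnj (fourier_exp s x))) + (cmod a)\<^sup>2"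
    unfolding pt using L2_integrable_sq[OF insert.prems(1)] i integrable_Re[OF i] integral_Re[OF i]
    by (simp only: Bochner_Integration.integral_add Bochner_Integration.integral_diff
        Bochner_Integration.integrable_diff integrable_mult_right integrable_const
        integral_mult_right_zero integral_const finite_measure.emeasure_finite) simp
  also have "(LINT x|\<mu>. cnj a * (f x * cnj (fourier_exp s x))) = cnj a * a"
    unfolding a_def L2_inner_def by simp
  also have "Re (cnj a * a) = (cmod a)\<^sup>2"
    by (simp add: cmod_power2) (simp add: power2_eq_square)
  finally have "norm_sq h = norm_sq f - (cmod a)\<^sup>2" by simp
  moreover have "(\<Sum>t\<in>A. (cmod (coeff h t))\<^sup>2) \<le> norm_sq h"
    using insert.prems by (intro insert.IH h) auto
  ultimately show ?case using insert.hyps c by (simp add: a_def)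
qed

lemma norm_sq_tendsto_zero:
  assumes s: "\<And>n. s n \<in> L2_space \<mu>" and f: "f \<in> L2_space \<mu>"
    and w: "integrable \<mu> w"
    and lim: "\<And>x. (\<lambda>n. s n x) \<longlonglongrightarrow> f x" and dom: "\<And>n x. (cmod (s n x - f x))\<^sup>2 \<le> w x"
  shows "(\<lambda>n. norm_sq (\<lambda>x. s n x - f x)) \<longlonglongrightarrow> 0"
proof -
  note [measurable] = L2_measurable[OF s] L2_measurable[OF f]
  have "(\<lambda>n. norm_sq (\<lambda>x. s n x - f x)) \<longlonglongrightarrow> (LINT x|\<mu>. 0)"
  proof (rule integral_dominated_convergence[where w=w])
    have "(\<lambda>n. (cmod (s n x - f x))\<^sup>2) \<longlonglongrightarrow> 0" for x
      using tendsto_power[OF tendsto_norm[OF LIM_zero[OF lim[of x]]], of 2] by simp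
    then show "AE x in \<mu>. (\<lambda>i. (cmod (s i x - f x))\<^sup>2) \<longlonglongrightarrow> 0" by simp
  qed (use w dom in auto)
  then show ?thesis by simp
qed

end

section \<open>Exponentials span a dense subspace\<close>

inductive trig_poly :: "(real \<Rightarrow> complex) \<Rightarrow> bool" where
  trig_poly_exp: "trig_poly (\<lambda>x. a * fourier_exp t x)"
| trig_poly_add: "trig_poly f \<Longrightarrow> trig_poly g \<Longrightarrow> trig_poly (\<lambda>x. f x + g x)"

lemma trig_poly_scale_exp:
  assumes "trig_poly f"
  shows "trig_poly (\<lambda>x. a * fourier_exp t x * f x)"
  using assms
proof induction
  case (trig_poly_exp b s)
  have "(\<lambda>x. a * fourier_exp t x * (b * fourier_exp s x)) = (\<lambda>x. (a * b) * fourier_exp (t + s) x)"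
    by (simp add: fourier_exp_add mult_ac)
  then show ?case by (simp add: trig_poly.trig_poly_exp)
next
  case (trig_poly_add f g)
  then show ?case using trig_poly.trig_poly_add by (simp add: distrib_left)
qed

lemma trig_poly_mult:
  assumes "trig_poly f" "trig_poly g"
  shows "trig_poly (\<lambda>x. f x * g x)"
  using assms(1)
proof induction
  case (trig_poly_exp a t)
  then show ?case by (rule trig_poly_scale_exp[OF assms(2)])
next
  case (trig_poly_add f h)
  then show ?case using trig_poly.trig_poly_add by (simp add: distrib_right)
qed

lemma trig_poly_continuous: "trig_poly f \<Longrightarrow> continuous_on A f"
  by (induction rule: trig_poly.induct) (intro continuous_intros | assumption)+

lemma trig_poly_sin: "trig_poly (\<lambda>x. complex_of_real (sin (2 * pi * t * x)))"
proof -
  have "complex_of_real (sin (2 * pi * t * x))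
      = (- \<i> / 2) * fourier_exp t x + (\<i> / 2) * fourier_exp (- t) x" for x
    by (rule complex_eqI) (simp_all add: fourier_exp_eq_cis)
  then show ?thesis
    using trig_poly_add[OF trig_poly_exp[of "- \<i> / 2" t] trig_poly_exp[of "\<i> / 2" "- t"]] by (simp only:)
qed

text \<open>Stone--Weierstrass on \<open>[-K, K]\<close>: the sine of period \<open>4K\<close> is injective there, so it separates the points.\<close>

lemma trig_poly_approximates_continuous:
  fixes \<phi> :: "real \<Rightarrow> real"
  assumes "continuous_on UNIV \<phi>" "e > 0" "K > 0"
  shows "\<exists>h. trig_poly h \<and> (\<forall>x. \<bar>x\<bar> \<le> K \<longrightarrow> cmod (h x - complex_of_real (\<phi> x)) < e)"
proof -
  have "\<exists>g. trig_poly (\<lambda>x. complex_of_real (g x)) \<and> (\<forall>x\<in>{-K..K}. \<bar>\<phi> x - g x\<bar> < e)"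
  proof (rule Stone_Weierstrass_HOL)
    show "trig_poly (\<lambda>x. complex_of_real c)" for c
      using trig_poly_exp[of "complex_of_real c" 0] by simp
    show "continuous_on {-K..K} g" if "trig_poly (\<lambda>x. complex_of_real (g x))" for g
      using continuous_on_Re[OF trig_poly_continuous[OF that]] by simp
    show "\<exists>f. trig_poly (\<lambda>x. complex_of_real (f x)) \<and> f x \<noteq> f y"
      if "x \<in> {-K..K} \<and> y \<in> {-K..K} \<and> x \<noteq> y" for x y
    proof -
      let ?a = "2 * pi * (1 / (4 * K))"
      have "\<bar>?a * z\<bar> \<le> pi / 2" if "z \<in> {-K..K}" for z
        using that assms(3) by (auto simp: abs_mult field_simps abs_le_iff)
      then have b: "- (pi / 2) \<le> ?a * z \<and> ?a * z \<le> pi / 2" if "z \<in> {-K..K}" for z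
        using that by (meson abs_le_iff minus_le_iff)
      have "sin (?a * x) \<noteq> sin (?a * y)"
      proof
        assume "sin (?a * x) = sin (?a * y)"
        then have "?a * x = ?a * y"
          using b that by (metis arcsin_sin)
        then show False using that assms(3) by simp
      qed
      then show ?thesis by (intro exI[of _ "\<lambda>x. sin (?a * x)"] conjI trig_poly_sin)
    qed
  qed (use assms in \<open>auto intro: trig_poly_add trig_poly_mult continuous_on_subset\<close>)
  then obtain g where g: "trig_poly (\<lambda>x. complex_of_real (g x))" "\<forall>x\<in>{-K..K}. \<bar>\<phi> x - g x\<bar> < e"
    by auto
  have "cmod (complex_of_real (g x) - complex_of_real (\<phi> x)) < e" if "\<bar>x\<bar> \<le> K" for x
  proof -
    have "\<bar>\<phi> x - g x\<bar> < e" using g(2)[rule_format, of x] that by (simp add: abs_le_iff)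
    then show ?thesis
      by (metis abs_minus_commute norm_of_real of_real_diff)
  qed
  with g(1) show ?thesis by blast
qed

text \<open>Induction principle expressing density: a linear property that is stable under
  \<open>L\<^sup>2\<close>-limits and holds for the exponentials holds for every square-integrable function.  The
  property climbs from trigonometric polynomials to continuous functions, then to indicators of
  half-lines, of Borel sets, and to simple functions.\<close>

theorem (in borel_probability) L2_exponential_induct [consumes 3, case_names exp add scale lim]:
  assumes K: "AE x in \<mu>. \<bar>x\<bar> \<le> K" "K > 0" and f: "f \<in> L2_space \<mu>"
    and P_exp: "\<And>t. P (fourier_exp t)"
    and P_add: "\<And>f g. f \<in> L2_space \<mu> \<Longrightarrow> g \<in> L2_space \<mu> \<Longrightarrow> P f \<Longrightarrow> P g \<Longrightarrow> P (\<lambda>x. f x + g x)"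
    and P_scale: "\<And>f a. f \<in> L2_space \<mu> \<Longrightarrow> P f \<Longrightarrow> P (\<lambda>x. a * f x)"
    and P_lim: "\<And>f s. f \<in> L2_space \<mu> \<Longrightarrow> (\<And>n::nat. s n \<in> L2_space \<mu>) \<Longrightarrow> (\<And>n. P (s n)) \<Longrightarrow>
        (\<lambda>n. norm_sq (\<lambda>x. s n x - f x)) \<longlonglongrightarrow> 0 \<Longrightarrow> P f"
  shows "P f"
proof -
  have trig_L2: "h \<in> L2_space \<mu>" if "trig_poly h" for h
    using that by induction (auto intro: L2_add L2_scale)
  have trig: "P h" if "trig_poly h" for h
    using that by induction (auto intro: P_exp P_add P_scale trig_L2)
  have cont: "P (\<lambda>x. complex_of_real (\<phi> x))"
    if c: "continuous_on UNIV \<phi>" and b: "\<And>x. \<bar>\<phi> x\<bar> \<le> 1" for \<phi>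
  proof -
    have [measurable]: "\<phi> \<in> borel_measurable borel"
      by (rule borel_measurable_continuous_onI[OF c])
    have L: "(\<lambda>x. complex_of_real (\<phi> x)) \<in> L2_space \<mu>"
      by (rule bounded_in_L2[where C=1]) (use b in auto)
    have "\<exists>h. trig_poly h \<and> (\<forall>x. \<bar>x\<bar> \<le> K \<longrightarrow> cmod (h x - complex_of_real (\<phi> x)) < 1 / real (Suc n))" for n
      by (rule trig_poly_approximates_continuous[OF c _ K(2)]) simp
    then obtain s where s: "\<And>n. trig_poly (s n)"
      "\<And>n x. \<bar>x\<bar> \<le> K \<Longrightarrow> cmod (s n x - complex_of_real (\<phi> x)) < 1 / real (Suc n)"
      by metis
    have le: "norm_sq (\<lambda>x. s n x - complex_of_real (\<phi> x)) \<le> (1 / real (Suc n))\<^sup>2" for n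
    proof -
      have "norm_sq (\<lambda>x. s n x - complex_of_real (\<phi> x)) \<le> (LINT x|\<mu>. (1 / real (Suc n))\<^sup>2)"
      proof (rule integral_mono_AE)
        show "integrable \<mu> (\<lambda>x. (cmod (s n x - complex_of_real (\<phi> x)))\<^sup>2)"
          by (rule L2_integrable_sq[OF L2_diff[OF trig_L2[OF s(1)] L]])
        show "AE x in \<mu>. (cmod (s n x - complex_of_real (\<phi> x)))\<^sup>2 \<le> (1 / real (Suc n))\<^sup>2"
          using K(1) by eventually_elim (rule power_mono[OF less_imp_le[OF s(2)]]; simp)
      qed auto
      then show ?thesis by simp
    qed
    have "(\<lambda>n. norm_sq (\<lambda>x. s n x - complex_of_real (\<phi> x))) \<longlonglongrightarrow> 0"
    proof (rule tendsto_sandwich[OF _ _ tendsto_const])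
      show "(\<lambda>n. (1 / real (Suc n))\<^sup>2) \<longlonglongrightarrow> 0"
        using tendsto_power[OF LIMSEQ_inverse_real_of_nat, of 2] by (simp add: inverse_eq_divide)
    qed (use le in \<open>auto intro!: always_eventually integral_nonneg_AE\<close>)
    then show ?thesis
      by (rule P_lim[OF L trig_L2[OF s(1)] trig[OF s(1)]])
  qed
  have ind_L2: "(\<lambda>x. complex_of_real (indicator A x)) \<in> L2_space \<mu>" if "A \<in> sets borel" for A
    using that by (intro bounded_in_L2[where C=1]) (auto simp: indicator_def)
  have half_line: "P (\<lambda>x. complex_of_real (indicator {..a} x))" for a
  proof -
    \<comment> \<open>Equal to one up to \<open>a\<close>, then decreasing to zero with slope \<open>-n\<close>.\<close>
    define \<phi> where "\<phi> n x = min 1 (max 0 (1 - real n * (x - a)))" for n x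
    have c: "continuous_on UNIV (\<phi> n)" for n unfolding \<phi>_def by (intro continuous_intros)
    have [measurable]: "\<phi> n \<in> borel_measurable borel" for n
      by (rule borel_measurable_continuous_onI[OF c])
    have b: "\<bar>\<phi> n x\<bar> \<le> 1" for n x by (auto simp: \<phi>_def)
    have lim: "(\<lambda>n. \<phi> n x) \<longlonglongrightarrow> indicator {..a} x" for x
    proof (cases "x \<le> a")
      case True
      then have "real n * (x - a) \<le> 0" for n by (simp add: mult_nonneg_nonpos)
      then have "\<phi> n x = 1" for n unfolding \<phi>_def
        by (metis add.right_neutral add_le_cancel_left diff_add_cancel max.absorb2 min.absorb1 order_trans zero_le_one le_diff_eq)
      with True show ?thesis by simp
    next
      case False
      obtain N :: nat where N: "1 < real N * (x - a)"
        using False reals_Archimedean3[of "x - a"] by auto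
      have "\<phi> n x = 0" if "n \<ge> N" for n
      proof -
        have "real N * (x - a) \<le> real n * (x - a)" using that False by (intro mult_right_mono) auto
        with N show ?thesis by (simp add: \<phi>_def)
      qed
      then have "(\<lambda>n. \<phi> n x) \<longlonglongrightarrow> 0"
        by (intro tendsto_eventually eventually_sequentiallyI)
      with False show ?thesis by simp
    qed
    have L: "(\<lambda>x. complex_of_real (\<phi> n x)) \<in> L2_space \<mu>" for n
      by (rule bounded_in_L2[where C=1]) (use b in auto)
    show ?thesis
    proof (rule P_lim[OF ind_L2 L cont[OF c b]])
      show "(\<lambda>n. norm_sq (\<lambda>x. complex_of_real (\<phi> n x) - complex_of_real (indicator {..a} x))) \<longlonglongrightarrow> 0"
      proof (rule norm_sq_tendsto_zero[OF L ind_L2, where w="\<lambda>_. 1"])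
        show "(cmod (complex_of_real (\<phi> n x) - complex_of_real (indicator {..a} x)))\<^sup>2 \<le> 1" for n x
          unfolding of_real_diff[symmetric] norm_of_real
          by (rule power_le_one) (auto simp: \<phi>_def indicator_def)
      qed (auto intro!: tendsto_of_real lim)
    qed simp
  qed
  have one: "P (\<lambda>x. 1)" using P_exp[of 0] by (metis ext fourier_exp_zero(1))
  have ind: "P (\<lambda>x. complex_of_real (indicator A x))" if "A \<in> sets borel" for A
  proof -
    let ?G = "range (\<lambda>a::real. {..a})"
    have b: "sigma_sets UNIV ?G = sets borel"
      by (subst borel_eq_atMost) (simp add: sets_measure_of)
    have "Int_stable ?G" unfolding Int_stable_def by auto
    moreover have "?G \<subseteq> Pow UNIV" by simp
    moreover have "A \<in> sigma_sets UNIV ?G" using that b by simp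
    ultimately show ?thesis
    proof (induction rule: sigma_sets_induct_disjoint)
      case (basic A)
      then show ?case using half_line by auto
    next
      case empty
      show ?case using P_scale[OF _ one, of 0] bounded_in_L2[of "\<lambda>_. 1" 1] by simp
    next
      case (compl A)
      then have "P (\<lambda>x. 1 + (-1) * complex_of_real (indicator A x))"
        using b by (intro P_add[OF _ L2_scale one P_scale] bounded_in_L2[where C=1]) (auto intro: ind_L2)
      moreover have "(\<lambda>x. 1 + (-1) * complex_of_real (indicator A x)) = (\<lambda>x. complex_of_real (indicator (UNIV - A) x))"
        by (auto simp: indicator_def)
      ultimately show ?case by simp
    next
      case (union A)
      have m: "A i \<in> sets borel" for i using union b by auto
      define s where "s n x = (\<Sum>i<n. complex_of_real (indicator (A i) x))" for n :: nat and x
      have sL: "s n \<in> L2_space \<mu>" for n unfolding s_def by (intro L2_sum ind_L2 m)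
      have sP: "P (s n)" for n
      proof (induction n)
        case 0
        show ?case using P_scale[OF _ one, of 0] bounded_in_L2[of "\<lambda>_. 1" 1] by (simp add: s_def)
      next
        case (Suc n)
        have "s (Suc n) = (\<lambda>x. s n x + complex_of_real (indicator (A n) x))" by (rule ext) (simp add: s_def)
        then show ?case using P_add[OF sL ind_L2[OF m] Suc union.IH] by simp
      qed
      have s: "s n x = complex_of_real (indicator (\<Union>i<n. A i) x)" for n x
      proof -
        have "disjoint_family_on A {..<n}" using union(1) by (rule disjoint_family_on_mono[rotated]) simp
        then have "(\<Sum>i<n. indicator (A i) x :: real) = indicator (\<Union>i<n. A i) x"
          by (intro indicator_UN_disjoint[symmetric]) auto
        then show ?thesis unfolding s_def by (metis of_real_sum)
      qed
      have mU: "(\<Union>i. A i) \<in> sets borel" using m by auto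
      show ?case
      proof (rule P_lim[OF ind_L2[OF mU] sL sP])
        show "(\<lambda>n. norm_sq (\<lambda>x. s n x - complex_of_real (indicator (\<Union>i. A i) x))) \<longlonglongrightarrow> 0"
        proof (rule norm_sq_tendsto_zero[OF sL ind_L2[OF mU], where w="\<lambda>_. 1"])
          show "(\<lambda>n. s n x) \<longlonglongrightarrow> complex_of_real (indicator (\<Union>i. A i) x)" for x
            unfolding s by (intro tendsto_of_real LIMSEQ_indicator_UN)
          show "(cmod (s n x - complex_of_real (indicator (\<Union>i. A i) x)))\<^sup>2 \<le> 1" for n x
            unfolding s of_real_diff[symmetric] norm_of_real
            by (rule power_le_one) (auto simp: indicator_def)
        qed simp
      qed
    qed
  qed
  have simple: "P g" if g: "simple_function \<mu> g" for g :: "real \<Rightarrow> complex"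
  proof -
    have fin: "finite (g ` UNIV)" using simple_functionD(1)[OF g] by simp
    have [measurable]: "g \<in> borel_measurable borel"
      using borel_measurable_simple_function[OF g] measurable_cong_sets[OF sets_eq refl] by auto
    have m: "g -` {y} \<in> sets borel" for y
      using measurable_sets_borel[of g borel "{y}"] by auto
    have "P (\<lambda>x. \<Sum>y\<in>Y. y * complex_of_real (indicator (g -` {y}) x))" if "finite Y" for Y
      using that
    proof induction
      case empty
      show ?case using P_scale[OF _ one, of 0] bounded_in_L2[of "\<lambda>_. 1" 1] by simp
    next
      case (insert y Y)
      have "P (\<lambda>x. y * complex_of_real (indicator (g -` {y}) x)
          + (\<Sum>y\<in>Y. y * complex_of_real (indicator (g -` {y}) x)))"
        by (rule P_add[OF L2_scale[OF ind_L2[OF m]] L2_sum P_scale[OF ind_L2[OF m] ind[OF m]] insert.IH])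
          (rule L2_scale[OF ind_L2[OF m]])
      then show ?case using insert.hyps by simp
    qed
    from this[OF fin] show ?thesis
    proof (rule back_subst[of P], intro ext)
      fix x
      have "g x = (\<Sum>y\<in>g ` UNIV. indicator (g -` {y} \<inter> UNIV) x *\<^sub>R y)"
        using simple_function_indicator_representation_banach[OF g, of x] unfolding space_eq by blast
      then show "(\<Sum>y\<in>g ` UNIV. y * complex_of_real (indicator (g -` {y}) x)) = g x"
        by (metis (no_types, lifting) Int_UNIV_right mult.commute scaleR_conv_of_real sum.cong)
    qed
  qed
  note [measurable] = L2_measurable[OF f]
  have "f \<in> borel_measurable \<mu>" by measurable
  from borel_measurable_implies_sequence_metric[OF this, of 0]
  obtain s where s: "\<And>i. simple_function \<mu> (s i)" "\<And>x. (\<lambda>i. s i x) \<longlonglongrightarrow> f x"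
      "\<And>i x. dist (s i x) 0 \<le> 2 * dist (f x) 0" by auto
  \<comment> \<open>The simple functions satisfy \<open>\<bar>s\<^sub>i\<bar> \<le> 2 \<bar>f\<bar>\<close>, so \<open>\<bar>s\<^sub>i - f\<bar>\<^sup>2 \<le> 9 \<bar>f\<bar>\<^sup>2\<close>.\<close>
  have w: "integrable \<mu> (\<lambda>x. 9 * (cmod (f x))\<^sup>2)" using L2_integrable_sq[OF f] by simp
  have sL: "s n \<in> L2_space \<mu>" for n
  proof (rule L2_spaceI)
    have m: "s n \<in> borel_measurable \<mu>" by (rule borel_measurable_simple_function[OF s(1)])
    then show "s n \<in> borel_measurable borel" using measurable_cong_sets[OF sets_eq refl] by auto
    show "integrable \<mu> (\<lambda>x. (cmod (s n x))\<^sup>2)"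
    proof (rule Bochner_Integration.integrable_bound[OF w])
      have "(cmod (s n x))\<^sup>2 \<le> (3 * cmod (f x))\<^sup>2" for x
      proof (rule power_mono)
        show "cmod (s n x) \<le> 3 * cmod (f x)" using s(3)[of n x] norm_ge_zero[of "f x"] by (simp; linarith)
      qed simp
      then show "AE x in \<mu>. norm ((cmod (s n x))\<^sup>2) \<le> norm (9 * (cmod (f x))\<^sup>2)"
        by (simp add: power_mult_distrib)
    qed (use m in simp)
  qed
  show ?thesis
  proof (rule P_lim[OF f sL simple[OF s(1)]])
    show "(\<lambda>n. norm_sq (\<lambda>x. s n x - f x)) \<longlonglongrightarrow> 0"
    proof (rule norm_sq_tendsto_zero[OF sL f w s(2)])
      fix n x
      have "cmod (s n x - f x) \<le> 3 * cmod (f x)"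
        using s(3)[of n x] norm_triangle_ineq4[of "s n x" "f x"] by simp
      then have "(cmod (s n x - f x))\<^sup>2 \<le> (3 * cmod (f x))\<^sup>2" by (rule power_mono) simp
      then show "(cmod (s n x - f x))\<^sup>2 \<le> 9 * (cmod (f x))\<^sup>2" by (simp add: power_mult_distrib)
    qed
  qed
qed

section \<open>Integration against the self-affine measure\<close>

locale affine_frame =
  fixes R :: int and B L :: "int set" and \<mu> :: "real measure" and \<alpha> :: "int \<Rightarrow> complex"
  assumes R_ge_2: "R \<ge> 2"
    and finite_B: "finite B" and zero_in_B: "0 \<in> B"
    and self_affine: "self_affine_measure R B \<mu>"
    and finite_L: "finite L" and zero_in_L: "0 \<in> L"
    and alpha_0: "\<alpha> 0 = 1"
    and orthonormal: "orthonormal_columns L B (T_matrix R B \<alpha>)"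

sublocale affine_frame \<subseteq> borel_probability \<mu>
  using self_affine unfolding self_affine_measure_def borel_probability_def borel_probability_axioms_def
  by auto

context affine_frame
begin

lemma R_pos: "real_of_int R > 0" using R_ge_2 by simp

lemma card_B_pos: "card B > 0" using finite_B zero_in_B by (auto simp: card_gt_0_iff)

lemma measurable_affine_map [measurable]: "affine_map R b \<in> borel_measurable borel"
  unfolding affine_map_def by measurable

lemma measurable_affine_map' [measurable]: "affine_map R b \<in> measurable \<mu> \<mu>"
  using measurable_affine_map measurable_cong_sets[OF sets_eq sets_eq] by auto

lemma measure_self_affine:
  "E \<in> sets borel \<Longrightarrow> prob E = 1 / real (card B) * (\<Sum>b\<in>B. prob (affine_map R b -` E))"
  using self_affine unfolding self_affine_measure_def by auto

lemma nn_integral_self_affine: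
  assumes "F \<in> borel_measurable \<mu>"
  shows "(\<integral>\<^sup>+x. F x \<partial>\<mu>) = ennreal (1 / real (card B)) * (\<Sum>b\<in>B. \<integral>\<^sup>+x. F (affine_map R b x) \<partial>\<mu>)"
  using assms
proof induction
  case (cong f g)
  then show ?case by (simp add: measurable_space)
next
  case (set A)
  then have A: "A \<in> sets borel" using sets_eq by simp
  have m: "affine_map R b -` A \<in> sets \<mu>" for b
    using measurable_sets_borel[OF measurable_affine_map A] sets_eq by simp
  have "(\<integral>\<^sup>+x. indicator A (affine_map R b x) \<partial>\<mu>) = ennreal (prob (affine_map R b -` A))" for b
  proof -
    have "(\<integral>\<^sup>+x. indicator A (affine_map R b x) \<partial>\<mu>) = (\<integral>\<^sup>+x. indicator (affine_map R b -` A) x \<partial>\<mu>)"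
      by (intro nn_integral_cong) (auto simp: indicator_def)
    then show ?thesis using m by (simp add: emeasure_eq_measure)
  qed
  moreover have "(\<integral>\<^sup>+x. indicator A x \<partial>\<mu>) = ennreal (prob A)"
    using set by (simp add: emeasure_eq_measure)
  ultimately show ?case
    unfolding measure_self_affine[OF A] by (simp add: ennreal_mult[symmetric] sum_nonneg)
next
  case (mult u c)
  then show ?case by (simp add: nn_integral_cmult sum_distrib_left[symmetric] mult.left_commute)
next
  case (add u v)
  then show ?case by (simp add: nn_integral_add sum.distrib distrib_left)
next
  case (seq U)
  have [measurable]: "\<And>i. U i \<in> borel_measurable \<mu>" by fact
  let ?I = "\<lambda>i b. \<integral>\<^sup>+x. U i (affine_map R b x) \<partial>\<mu>"
  have inc: "incseq (\<lambda>i. ?I i b)" for b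
    using \<open>incseq U\<close> by (auto simp: incseq_def le_fun_def intro!: nn_integral_mono)
  have "(\<integral>\<^sup>+x. (SUP i. U i) (affine_map R b x) \<partial>\<mu>) = (SUP i. ?I i b)" for b
    unfolding SUP_apply using \<open>incseq U\<close>
    by (intro nn_integral_monotone_convergence_SUP) (auto simp: incseq_def le_fun_def)
  then have "ennreal (1 / real (card B)) * (\<Sum>b\<in>B. \<integral>\<^sup>+x. (SUP i. U i) (affine_map R b x) \<partial>\<mu>)
      = ennreal (1 / real (card B)) * (\<Sum>b\<in>B. SUP i. ?I i b)" by simp
  also have "\<dots> = (SUP i. ennreal (1 / real (card B)) * (\<Sum>b\<in>B. ?I i b))"
    by (subst ennreal_SUP_sum[symmetric, OF inc]) (simp add: SUP_mult_left_ennreal)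
  also have "\<dots> = (SUP i. \<integral>\<^sup>+x. U i x \<partial>\<mu>)" using seq.IH by simp
  also have "\<dots> = (\<integral>\<^sup>+x. (SUP i. U i) x \<partial>\<mu>)"
    unfolding SUP_apply using \<open>incseq U\<close>
    by (intro nn_integral_monotone_convergence_SUP[symmetric]) auto
  finally show ?case by simp
qed

lemma integrable_comp_affine:
  fixes F :: "real \<Rightarrow> 'b::{banach, second_countable_topology}"
  assumes "integrable \<mu> F" "b \<in> B"
  shows "integrable \<mu> (\<lambda>x. F (affine_map R b x))"
proof -
  have [measurable]: "F \<in> borel_measurable \<mu>" using assms by auto
  have "ennreal (1 / real (card B)) * (\<Sum>b\<in>B. \<integral>\<^sup>+x. norm (F (affine_map R b x)) \<partial>\<mu>) < \<infinity>"
    using assms(1) nn_integral_self_affine[of "\<lambda>x. ennreal (norm (F x))"]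
    by (simp add: integrable_iff_bounded)
  then have "(\<Sum>b\<in>B. \<integral>\<^sup>+x. norm (F (affine_map R b x)) \<partial>\<mu>) < \<infinity>"
    using card_B_pos by (auto simp: ennreal_mult_less_top)
  then have "(\<integral>\<^sup>+x. norm (F (affine_map R b x)) \<partial>\<mu>) < \<infinity>"
    using assms(2) finite_B by (simp add: less_top)
  then show ?thesis by (simp add: integrable_iff_bounded)
qed

lemma integral_self_affine:
  fixes F :: "real \<Rightarrow> 'b::{banach, second_countable_topology}"
  assumes "integrable \<mu> F"
  shows "(LINT x|\<mu>. F x) = (1 / real (card B)) *\<^sub>R (\<Sum>b\<in>B. LINT x|\<mu>. F (affine_map R b x))"
  using assms
proof induction
  case (base A c)
  then have A: "A \<in> sets borel" using sets_eq by simp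
  have m: "affine_map R b -` A \<in> sets \<mu>" for b
    using measurable_sets_borel[OF measurable_affine_map A] sets_eq by simp
  have "(LINT x|\<mu>. indicator A (affine_map R b x) *\<^sub>R c) = prob (affine_map R b -` A) *\<^sub>R c" for b
  proof -
    have "(\<lambda>x. indicator A (affine_map R b x) *\<^sub>R c) = (\<lambda>x. indicator (affine_map R b -` A) x *\<^sub>R c)"
      by (auto simp: indicator_def)
    then show ?thesis using m[of b] by (simp add: emeasure_eq_measure)
  qed
  then show ?case
    using base measure_self_affine[OF A] by (simp add: scaleR_sum_left[symmetric])
next
  case (add f g)
  then show ?case
    by (simp add: integrable_comp_affine sum.distrib scaleR_add_right)
next
  case (lim f s)
  have f: "integrable \<mu> f" by fact
  have IH: "\<And>i. (LINT x|\<mu>. s i x) = (1 / real (card B)) *\<^sub>R (\<Sum>b\<in>B. LINT x|\<mu>. s i (affine_map R b x))"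
    by fact
  have [measurable]: "f \<in> borel_measurable \<mu>" "\<And>i. s i \<in> borel_measurable \<mu>" using lim by auto
  have "(\<lambda>i. LINT x|\<mu>. s i x) \<longlonglongrightarrow> (LINT x|\<mu>. f x)"
    using lim by (intro integral_dominated_convergence[where w="\<lambda>x. 2 * norm (f x)"]) auto
  moreover have "(\<lambda>i. LINT x|\<mu>. s i (affine_map R b x)) \<longlonglongrightarrow> (LINT x|\<mu>. f (affine_map R b x))" if "b \<in> B" for b
    using lim integrable_comp_affine[OF f that]
    by (intro integral_dominated_convergence[where w="\<lambda>x. 2 * norm (f (affine_map R b x))"]) auto
  then have "(\<lambda>i. LINT x|\<mu>. s i x) \<longlonglongrightarrow> (1 / real (card B)) *\<^sub>R (\<Sum>b\<in>B. LINT x|\<mu>. f (affine_map R b x))"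
    unfolding IH by (intro tendsto_intros)
  ultimately show ?case by (rule LIMSEQ_unique)
qed

text \<open>If \<open>K \<ge> \<bar>b\<bar> + 1\<close> for every digit \<open>b\<close>, then \<open>\<bar>\<tau>\<^sub>b x\<bar> > K\<close> forces \<open>\<bar>x\<bar> > K + 1\<close>, so the mass outside
  \<open>[-K, K]\<close> already lies outside \<open>[-K - n, K + n]\<close> for every \<open>n\<close>.\<close>

lemma compact_support: "\<exists>K>0. AE x in \<mu>. \<bar>x\<bar> \<le> K"
proof -
  define D where "D = (\<Sum>b\<in>B. \<bar>real_of_int b\<bar>)"
  have D: "\<bar>real_of_int b\<bar> \<le> D" if "b \<in> B" for b
    unfolding D_def using finite_B that by (intro member_le_sum) auto
  have D0: "D \<ge> 0" unfolding D_def by (intro sum_nonneg) auto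
  define T where "T K = {x::real. K < \<bar>x\<bar>}" for K
  have T: "T K \<in> sets borel" for K unfolding T_def by measurable
  have step: "prob (T K) \<le> prob (T (K + 1))" if K: "K \<ge> D + 1" for K
  proof -
    have "prob (affine_map R b -` T K) \<le> prob (T (K + 1))" if b: "b \<in> B" for b
    proof (rule finite_measure_mono)
      show "affine_map R b -` T K \<subseteq> T (K + 1)"
      proof
        fix x assume "x \<in> affine_map R b -` T K"
        then have "K * R < \<bar>x + b\<bar>"
          using R_pos by (simp add: T_def affine_map_def abs_divide pos_less_divide_eq)
        moreover have "K * 2 \<le> K * R" using K D0 R_ge_2 by (intro mult_left_mono) auto
        ultimately show "x \<in> T (K + 1)" using D[OF b] K by (simp add: T_def)
      qed
    qed (simp add: sets_eq T)
    then have "(\<Sum>b\<in>B. prob (affine_map R b -` T K)) \<le> (\<Sum>b\<in>B. prob (T (K + 1)))"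
      by (rule sum_mono)
    then show ?thesis
      unfolding measure_self_affine[OF T[of K]] using card_B_pos by (simp add: field_simps)
  qed
  have le: "prob (T (D + 1)) \<le> prob (T (D + 1 + real n))" for n
  proof (induction n)
    case (Suc n)
    with step[of "D + 1 + real n"] show ?case by (simp add: add_ac)
  qed simp
  have "(\<lambda>n. prob (T (D + 1 + real n))) \<longlonglongrightarrow> prob (\<Inter>n. T (D + 1 + real n))"
  proof (rule finite_Lim_measure_decseq)
    show "range (\<lambda>n. T (D + 1 + real n)) \<subseteq> sets \<mu>" unfolding sets_eq using T by blast
    show "decseq (\<lambda>n. T (D + 1 + real n))" unfolding decseq_def T_def by force
  qed
  moreover have "(\<Inter>n. T (D + 1 + real n)) = {}"
  proof -
    have "\<exists>n. x \<notin> T (D + 1 + real n)" for x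
    proof -
      obtain n :: nat where "\<bar>x\<bar> \<le> real n" using real_arch_simple by blast
      then show ?thesis using D0 by (intro exI[of _ n]) (simp add: T_def)
    qed
    then show ?thesis by auto
  qed
  ultimately have "(\<lambda>n. prob (T (D + 1 + real n))) \<longlonglongrightarrow> 0" by simp
  then have "prob (T (D + 1)) \<le> 0"
    by (rule LIMSEQ_le_const) (use le in auto)
  then have "prob (T (D + 1)) = 0" using measure_nonneg[of \<mu>] by (simp add: antisym)
  then have "AE x in \<mu>. x \<notin> T (D + 1)"
    by (intro AE_not_in) (simp add: null_sets_def emeasure_eq_measure sets_eq T)
  then show ?thesis using D0 by (intro exI[of _ "D + 1"]) (auto simp: T_def not_less)
qed

end

section \<open>The row of operators attached to the matrix\<close>

lemma orthonormal_columns_isometry: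
  fixes T :: "'r \<Rightarrow> 'c \<Rightarrow> complex"
  assumes "orthonormal_columns L B T" "finite B"
  shows "(\<Sum>l\<in>L. (cmod (\<Sum>b\<in>B. cnj (T l b) * u b))\<^sup>2) = (\<Sum>b\<in>B. (cmod (u b))\<^sup>2)"
proof -
  have "complex_of_real (\<Sum>l\<in>L. (cmod (\<Sum>b\<in>B. cnj (T l b) * u b))\<^sup>2)
      = (\<Sum>l\<in>L. (\<Sum>b\<in>B. cnj (T l b) * u b) * (\<Sum>b'\<in>B. T l b' * cnj (u b')))"
    by (simp add: complex_norm_square del: of_real_power)
  also have "\<dots> = (\<Sum>l\<in>L. \<Sum>b\<in>B. \<Sum>b'\<in>B. (u b * cnj (u b')) * (T l b' * cnj (T l b)))"
    by (simp add: sum_product mult_ac)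
  also have "\<dots> = (\<Sum>b\<in>B. \<Sum>b'\<in>B. (u b * cnj (u b')) * (\<Sum>l\<in>L. T l b' * cnj (T l b)))"
    by (subst sum.swap, rule sum.cong[OF refl], subst sum.swap) (simp add: sum_distrib_left)
  also have "\<dots> = (\<Sum>b\<in>B. \<Sum>b'\<in>B. if b' = b then u b * cnj (u b') else 0)"
    using assms(1) unfolding orthonormal_columns_def by (intro sum.cong refl) auto
  also have "\<dots> = complex_of_real (\<Sum>b\<in>B. (cmod (u b))\<^sup>2)"
    using assms(2) by (simp add: complex_norm_square del: of_real_power)
  finally show ?thesis by (simp only: of_real_eq_iff)
qed

context affine_frame
begin

text \<open>This is the adjoint of \<open>S\<^sub>l f = \<alpha>\<^sub>l e\<^sub>l (f \<circ> r)\<close>, where \<open>r(x) = R x - b\<close> on the image of \<open>\<tau>\<^sub>b\<close>.  The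
  operators \<open>S\<^sub>l\<close> form a row \<open>(S\<^sub>l)\<^sub>l\<close> with \<open>\<Sum>\<^sub>l S\<^sub>l S\<^sub>l\<^sup>* = 1\<close>, and only their adjoints occur below.\<close>

definition cuntz_adj :: "int \<Rightarrow> (real \<Rightarrow> complex) \<Rightarrow> real \<Rightarrow> complex" where
  "cuntz_adj l f x = cnj (\<alpha> l) / of_nat (card B) *
     (\<Sum>b\<in>B. cnj (fourier_exp (of_int l) (affine_map R b x)) * f (affine_map R b x))"

lemma cuntz_adj_add: "cuntz_adj l (\<lambda>x. f x + g x) = (\<lambda>x. cuntz_adj l f x + cuntz_adj l g x)"
  unfolding cuntz_adj_def by (rule ext) (simp add: distrib_left sum.distrib)

lemma cuntz_adj_scale: "cuntz_adj l (\<lambda>x. a * f x) = (\<lambda>x. a * cuntz_adj l f x)"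
  unfolding cuntz_adj_def by (rule ext) (simp add: sum_distrib_left mult_ac)

lemma cuntz_adj_T_matrix:
  "cuntz_adj l f x = cnj (fourier_exp (of_int l) (x / of_int R)) / of_real (sqrt (card B)) *
     (\<Sum>b\<in>B. cnj (T_matrix R B \<alpha> l b) * f (affine_map R b x))"
proof -
  have e: "fourier_exp (of_int l) (affine_map R b x)
      = fourier_exp (of_int l) (x / of_int R) * exp (2 * complex_of_real pi * \<i> * of_int l * of_int b / of_int R)" for b
    unfolding affine_map_def add_divide_distrib fourier_exp_add_right
    by (simp add: fourier_exp_def)
  have s: "complex_of_real (sqrt (card B)) * complex_of_real (sqrt (card B)) = of_nat (card B)"
    unfolding of_real_mult[symmetric] by simp
  have "cnj (T_matrix R B \<alpha> l b) = 1 / complex_of_real (sqrt (card B)) *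
      (cnj (exp (2 * complex_of_real pi * \<i> * of_int l * of_int b / of_int R)) * cnj (\<alpha> l))" for b
    unfolding T_matrix_def by simp
  then show ?thesis
    unfolding cuntz_adj_def e s[symmetric] by (simp add: sum_distrib_left mult_ac)
qed

text \<open>The factor of \<open>e\<^sub>l(\<tau>\<^sub>b x)\<close> that depends on \<open>x\<close> has modulus one, so pointwise in \<open>x\<close> the operators
  act on the vector \<open>(f(\<tau>\<^sub>b x))\<^sub>b\<close> as the isometry given by the matrix.\<close>

lemma cuntz_adj_isometry_pointwise:
  "(\<Sum>l\<in>L. (cmod (cuntz_adj l f x))\<^sup>2) = (1 / card B) * (\<Sum>b\<in>B. (cmod (f (affine_map R b x)))\<^sup>2)"
proof -
  have "(cmod (cuntz_adj l f x))\<^sup>2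
      = (1 / card B) * (cmod (\<Sum>b\<in>B. cnj (T_matrix R B \<alpha> l b) * f (affine_map R b x)))\<^sup>2" for l
    unfolding cuntz_adj_T_matrix by (simp add: norm_mult norm_divide power_divide power_mult_distrib)
  then show ?thesis
    using orthonormal_columns_isometry[OF orthonormal finite_B]
    by (simp add: sum_divide_distrib[symmetric])
qed

lemma L2_comp_affine:
  assumes "f \<in> L2_space \<mu>" "b \<in> B"
  shows "(\<lambda>x. f (affine_map R b x)) \<in> L2_space \<mu>"
proof (rule L2_spaceI)
  note [measurable] = L2_measurable[OF assms(1)]
  show "(\<lambda>x. f (affine_map R b x)) \<in> borel_measurable borel" by measurable
  show "integrable \<mu> (\<lambda>x. (cmod (f (affine_map R b x)))\<^sup>2)"
    by (rule integrable_comp_affine[OF L2_integrable_sq[OF assms(1)] assms(2)])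
qed

lemma L2_mult_fourier_exp:
  assumes "f \<in> L2_space \<mu>"
  shows "(\<lambda>x. cnj (fourier_exp s x) * f x) \<in> L2_space \<mu>"
proof (rule L2_spaceI)
  note [measurable] = L2_measurable[OF assms]
  show "(\<lambda>x. cnj (fourier_exp s x) * f x) \<in> borel_measurable borel"
    unfolding cnj_fourier_exp by measurable
qed (simp add: norm_mult L2_integrable_sq[OF assms])

lemma cuntz_adj_L2 [simp, intro]:
  assumes "f \<in> L2_space \<mu>"
  shows "cuntz_adj l f \<in> L2_space \<mu>"
proof -
  have "(\<lambda>x. cnj (fourier_exp (of_int l) (affine_map R b x)) * f (affine_map R b x)) \<in> L2_space \<mu>"
    if "b \<in> B" for b
    by (rule L2_comp_affine[OF L2_mult_fourier_exp[OF assms] that])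
  then show ?thesis
    unfolding cuntz_adj_def[abs_def] by (intro L2_scale L2_sum)
qed

lemma sum_norm_sq_cuntz_adj:
  assumes "f \<in> L2_space \<mu>"
  shows "(\<Sum>l\<in>L. norm_sq (cuntz_adj l f)) = norm_sq f"
proof -
  have "(\<Sum>l\<in>L. norm_sq (cuntz_adj l f)) = (LINT x|\<mu>. (\<Sum>l\<in>L. (cmod (cuntz_adj l f x))\<^sup>2))"
    by (rule Bochner_Integration.integral_sum[symmetric]) (rule L2_integrable_sq[OF cuntz_adj_L2[OF assms]])
  also have "\<dots> = (1 / card B) * (\<Sum>b\<in>B. LINT x|\<mu>. (cmod (f (affine_map R b x)))\<^sup>2)"
    unfolding cuntz_adj_isometry_pointwise
    by (subst integral_mult_right_zero, subst Bochner_Integration.integral_sum)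
       (auto intro: integrable_comp_affine[OF L2_integrable_sq[OF assms]])
  also have "\<dots> = norm_sq f"
    using integral_self_affine[OF L2_integrable_sq[OF assms]] by simp
  finally show ?thesis .
qed

lemma cuntz_adj_fourier_exp:
  "cuntz_adj l (fourier_exp t)
     = (\<lambda>x. (cnj (\<alpha> l) * m_fun B (g_map R l t)) * fourier_exp (g_map R l t) x)"
proof
  fix x
  have "cnj (fourier_exp (of_int l) (affine_map R b x)) * fourier_exp t (affine_map R b x)
      = fourier_exp (of_int b) (g_map R l t) * fourier_exp (g_map R l t) x" for b
  proof -
    have "fourier_exp (t - of_int l) (affine_map R b x) = fourier_exp (g_map R l t) (of_int b + x)"
      by (simp add: fourier_exp_eq_cis affine_map_def g_map_def add.commute)
    then show ?thesis
      by (simp add: fourier_exp_diff fourier_exp_add_right fourier_exp_commute[of "g_map R l t" "of_int b"] mult.commute)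
  qed
  then show "cuntz_adj l (fourier_exp t) x
      = (cnj (\<alpha> l) * m_fun B (g_map R l t)) * fourier_exp (g_map R l t) x"
    unfolding cuntz_adj_def m_fun_def by (simp add: sum_distrib_right[symmetric])
qed

lemma quadrature_mirror: "(\<Sum>l\<in>L. (cmod (\<alpha> l * m_fun B (g_map R l t)))\<^sup>2) = 1"
  using sum_norm_sq_cuntz_adj[OF fourier_exp_in_L2[of t]]
  unfolding cuntz_adj_fourier_exp norm_sq_scale by (simp add: norm_mult)

text \<open>Points of the annihilator of \<open>B\<close>.  For them, \<open>e\<^sub>R\<^sub>s(\<tau>\<^sub>b x) = e\<^sub>s(x)\<close> for every digit \<open>b\<close>.\<close>

definition dual_point :: "real \<Rightarrow> bool" where
  "dual_point s \<longleftrightarrow> (\<forall>b\<in>B. fourier_exp (of_int b) s = 1)"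

lemma dual_point_of_int [simp]: "dual_point (of_int k)"
  by (simp add: dual_point_def)

lemma dual_point_add: "dual_point s \<Longrightarrow> dual_point t \<Longrightarrow> dual_point (s + t)"
  by (simp add: dual_point_def fourier_exp_add_right)

lemma dual_point_mult_int:
  assumes "dual_point s"
  shows "dual_point (of_int k * s)"
proof -
  have "fourier_exp (of_int b) (of_int k * s) = fourier_exp (of_int b) s powi k" for b
    unfolding fourier_exp_eq_cis cis_power_int by (simp add: mult_ac)
  then show ?thesis using assms by (simp add: dual_point_def)
qed

lemma m_fun_dual_point: "dual_point s \<Longrightarrow> m_fun B s = 1"
  using card_B_pos by (simp add: dual_point_def m_fun_def)

lemma m_fun_add_dual_point: "dual_point s \<Longrightarrow> m_fun B (t + s) = m_fun B t"
  by (simp add: dual_point_def m_fun_def fourier_exp_add_right)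

lemma coeff_cuntz_adj:
  assumes "f \<in> L2_space \<mu>" "dual_point s"
  shows "coeff (cuntz_adj l f) s = cnj (\<alpha> l) * coeff f (of_int l + of_int R * s)"
proof -
  let ?F = "\<lambda>x. f x * cnj (fourier_exp (of_int l + of_int R * s) x)"
  have F: "?F (affine_map R b x) = cnj (fourier_exp (of_int l) (affine_map R b x)) * f (affine_map R b x)
      * cnj (fourier_exp s x)" if "b \<in> B" for b x
  proof -
    have "fourier_exp (of_int R * s) (affine_map R b x) = fourier_exp s (of_int b + x)"
      using R_pos by (simp add: fourier_exp_eq_cis affine_map_def add.commute mult.assoc)
    then have "fourier_exp (of_int R * s) (affine_map R b x) = fourier_exp s x"
      using assms(2) that by (simp add: dual_point_def fourier_exp_add_right fourier_exp_commute[of s "of_int b"])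
    then show ?thesis by (simp add: fourier_exp_add)
  qed
  have "coeff (cuntz_adj l f) s
      = (LINT x|\<mu>. cnj (\<alpha> l) / of_nat (card B) * (\<Sum>b\<in>B. ?F (affine_map R b x)))"
    unfolding L2_inner_def cuntz_adj_def by (simp add: F sum_distrib_right mult.assoc)
  also have "\<dots> = cnj (\<alpha> l) / of_nat (card B) * (\<Sum>b\<in>B. LINT x|\<mu>. ?F (affine_map R b x))"
    by (subst integral_mult_right_zero, subst Bochner_Integration.integral_sum)
       (auto intro: integrable_comp_affine[OF coeff_integrable[OF assms(1)]])
  also have "\<dots> = cnj (\<alpha> l) * coeff f (of_int l + of_int R * s)"
    unfolding L2_inner_def integral_self_affine[OF coeff_integrable[OF assms(1)]]
    by (simp add: scaleR_conv_of_real)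
  finally show ?thesis .
qed

primrec cuntz_word :: "int list \<Rightarrow> (real \<Rightarrow> complex) \<Rightarrow> real \<Rightarrow> complex" where
  "cuntz_word [] f = f"
| "cuntz_word (l # w) f = cuntz_word w (cuntz_adj l f)"

lemma cuntz_word_append: "cuntz_word (u @ v) f = cuntz_word v (cuntz_word u f)"
  by (induction u arbitrary: f) auto

lemma cuntz_word_L2 [simp, intro]: "f \<in> L2_space \<mu> \<Longrightarrow> cuntz_word w f \<in> L2_space \<mu>"
  by (induction w arbitrary: f) auto

lemma cuntz_word_add: "cuntz_word w (\<lambda>x. f x + g x) = (\<lambda>x. cuntz_word w f x + cuntz_word w g x)"
  by (induction w arbitrary: f g) (auto simp: cuntz_adj_add)

lemma cuntz_word_scale: "cuntz_word w (\<lambda>x. a * f x) = (\<lambda>x. a * cuntz_word w f x)"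
  by (induction w arbitrary: f) (auto simp: cuntz_adj_scale)

lemma sum_norm_sq_cuntz_word:
  "f \<in> L2_space \<mu> \<Longrightarrow> (\<Sum>w | set w \<subseteq> L \<and> length w = n. norm_sq (cuntz_word w f)) = norm_sq f"
proof (induction n arbitrary: f)
  case 0
  have "{w. set w \<subseteq> L \<and> w = []} = {[]}" by auto
  then show ?case by simp
next
  case (Suc n)
  let ?W = "\<lambda>n. {w. set w \<subseteq> L \<and> length w = n}"
  have "?W (Suc n) = (\<lambda>(l, w). l # w) ` (L \<times> ?W n)"
    by (force simp: length_Suc_conv)
  moreover have "inj_on (\<lambda>(l, w). l # w) (L \<times> ?W n)" by (auto simp: inj_on_def)
  ultimately have "(\<Sum>w\<in>?W (Suc n). norm_sq (cuntz_word w f))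
      = (\<Sum>(l, w)\<in>L \<times> ?W n. norm_sq (cuntz_word w (cuntz_adj l f)))"
    by (simp add: sum.reindex case_prod_unfold)
  also have "\<dots> = (\<Sum>l\<in>L. norm_sq (cuntz_adj l f))"
    unfolding sum.cartesian_product[symmetric] using Suc by (auto intro!: sum.cong)
  finally show ?case using sum_norm_sq_cuntz_adj[OF Suc.prems] by simp
qed

lemma word_weight_simps [simp]:
  "word_weight \<alpha> [] = 1" "word_weight \<alpha> (l # w) = \<alpha> l * word_weight \<alpha> w"
  unfolding word_weight_def by (simp_all add: prod.lessThan_Suc_shift del: prod.lessThan_Suc)

lemma word_frequency_simps [simp]:
  "word_frequency R [] s = s"
  "word_frequency R (l # w) s = of_int l + of_int R * word_frequency R w s"
  unfolding word_frequency_def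
  by (simp_all add: sum.lessThan_Suc_shift sum_distrib_left algebra_simps del: sum.lessThan_Suc)

lemma dual_point_word_frequency: "dual_point s \<Longrightarrow> dual_point (word_frequency R w s)"
  by (induction w) (auto intro!: dual_point_add dual_point_mult_int)

lemma coeff_cuntz_word:
  assumes "f \<in> L2_space \<mu>" "dual_point s"
  shows "L2_inner \<mu> f (\<lambda>x. word_weight \<alpha> w * fourier_exp (word_frequency R w s) x) = coeff (cuntz_word w f) s"
proof -
  have "coeff (cuntz_word w f) s = cnj (word_weight \<alpha> w) * coeff f (word_frequency R w s)"
    using assms
    by (induction w arbitrary: f) (auto simp: coeff_cuntz_adj dual_point_word_frequency)
  moreover have "L2_inner \<mu> f (\<lambda>x. a * fourier_exp t x) = cnj a * coeff f t" for a t
    unfolding L2_inner_def by (simp add: mult.left_commute)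
  ultimately show ?thesis by simp
qed

end

section \<open>Points of min-sets\<close>

lemma g_word_simps [simp]:
  "g_word R [] t = t" "g_word R (l # w) t = g_word R w (g_map R l t)"
  by (simp_all add: g_word_def)

lemma g_word_append [simp]: "g_word R (u @ v) t = g_word R v (g_word R u t)"
  by (simp add: g_word_def)

context affine_frame
begin

lemma g_map_inverse: "of_int l + of_int R * g_map R l t = t"
  using R_pos by (simp add: g_map_def)

lemma g_word_inject: "g_word R w s = g_word R w t \<Longrightarrow> s = t"
proof (induction w arbitrary: s t)
  case (Cons l w)
  then have "g_map R l s = g_map R l t" by simp
  then show ?case using g_map_inverse by metis
qed simp

lemma g_word_integer_part: "\<exists>k::int. of_int R ^ length w * g_word R w t = t - of_int k"
proof (induction w arbitrary: t)
  case Nil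
  show ?case by (intro exI[of _ 0]) simp
next
  case (Cons l w)
  obtain k :: int where "of_int R ^ length w * g_word R w (g_map R l t) = g_map R l t - of_int k"
    using Cons by blast
  then have "of_int R ^ length (l # w) * g_word R (l # w) t = of_int R * g_map R l t - of_int (R * k)"
    by (simp add: mult.assoc right_diff_distrib)
  also have "\<dots> = t - of_int (l + R * k)" using g_map_inverse[of l t] by simp
  finally show ?case by blast
qed

primrec admissible :: "real \<Rightarrow> int list \<Rightarrow> bool" where
  "admissible t [] \<longleftrightarrow> True"
| "admissible t (l # w) \<longleftrightarrow> l \<in> L \<and> possible R B \<alpha> t l \<and> admissible (g_map R l t) w"

lemma admissible_append: "admissible t (u @ v) \<longleftrightarrow> admissible t u \<and> admissible (g_word R u t) v"
  by (induction u arbitrary: t) auto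

lemma admissible_letters: "admissible t w \<Longrightarrow> set w \<subseteq> L"
  by (induction w arbitrary: t) auto

lemma admissible_iff:
  "admissible t w \<longleftrightarrow> set w \<subseteq> L \<and> (\<forall>k < length w. possible R B \<alpha> (g_word R (take k w) t) (w ! k))"
  by (induction w arbitrary: t) (auto simp: All_less_Suc2)

lemma possible_exists: "\<exists>l\<in>L. possible R B \<alpha> t l"
proof (rule ccontr)
  assume "\<not> ?thesis"
  then have "(\<Sum>l\<in>L. (cmod (\<alpha> l * m_fun B (g_map R l t)))\<^sup>2) = 0"
    by (intro sum.neutral) (auto simp: possible_def)
  then show False using quadrature_mirror[of t] by simp
qed

abbreviation is_min_set :: "real set \<Rightarrow> bool" where
  "is_min_set \<equiv> min_set R B L \<alpha>"

lemma min_set_step: "is_min_set M \<Longrightarrow> t \<in> M \<Longrightarrow> l \<in> L \<Longrightarrow> possible R B \<alpha> t l \<Longrightarrow> g_map R l t \<in> M"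
  unfolding min_set_def invariant_set_def by auto

lemma min_set_finite: "is_min_set M \<Longrightarrow> finite M"
  unfolding min_set_def by auto

lemma admissible_min_set: "is_min_set M \<Longrightarrow> t \<in> M \<Longrightarrow> admissible t w \<Longrightarrow> g_word R w t \<in> M"
  by (induction w arbitrary: t) (auto intro: min_set_step)

lemma min_sets_disjoint:
  assumes "is_min_set M" "is_min_set M'" "M \<noteq> M'"
  shows "M \<inter> M' = {}"
proof (rule ccontr)
  assume "M \<inter> M' \<noteq> {}"
  then have i: "invariant_set R B L \<alpha> (M \<inter> M')"
    using assms unfolding invariant_set_def by (auto intro: min_set_step)
  have "M \<inter> M' = M \<and> M \<inter> M' = M'"
    using i assms(1,2) unfolding min_set_def by (metis Int_lower1 Int_lower2 psubsetI)
  then show False using assms(3) by metis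
qed

lemma finite_invariant_contains_min_set:
  assumes "finite Z" "invariant_set R B L \<alpha> Z"
  shows "\<exists>M\<subseteq>Z. is_min_set M"
  using assms
proof (induction Z rule: finite_psubset_induct)
  case (psubset Z)
  show ?case
  proof (cases "is_min_set Z")
    case False
    then obtain Z' where Z': "Z' \<subset> Z" "invariant_set R B L \<alpha> Z'"
      using psubset(1,3) unfolding min_set_def by auto
    obtain M where "M \<subseteq> Z'" "is_min_set M" using psubset.IH[OF Z'] by auto
    then show ?thesis using Z'(1) by (intro exI[of _ M]) auto
  qed auto
qed

text \<open>The points reached from \<open>t\<close> in at least one step form an invariant subset of the min-set, hence all
  of it; in particular \<open>t\<close> itself is reached again.\<close>

lemma min_set_reachable:
  assumes M: "is_min_set M" and "t \<in> M" "s \<in> M"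
  shows "\<exists>w. w \<noteq> [] \<and> admissible t w \<and> g_word R w t = s"
proof -
  define Z where "Z = {g_word R w t | w. w \<noteq> [] \<and> admissible t w}"
  have ZM: "Z \<subseteq> M" using admissible_min_set[OF M assms(2)] by (auto simp: Z_def)
  obtain l where l: "l \<in> L" "possible R B \<alpha> t l" using possible_exists by blast
  then have "g_word R [l] t \<in> Z" unfolding Z_def by fastforce
  moreover have "g_map R l' z \<in> Z" if "z \<in> Z" "l' \<in> L" "possible R B \<alpha> z l'" for z l'
  proof -
    obtain w where w: "z = g_word R w t" "admissible t w" using \<open>z \<in> Z\<close> unfolding Z_def by blast
    then have "admissible t (w @ [l'])" "g_map R l' z = g_word R (w @ [l']) t"
      using that by (auto simp: admissible_append)
    then show ?thesis unfolding Z_def by blast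
  qed
  ultimately have "invariant_set R B L \<alpha> Z" unfolding invariant_set_def by auto
  then have "Z = M" using M ZM unfolding min_set_def by blast
  then show ?thesis using assms(3) by (auto simp: Z_def)
qed

text \<open>Every point of a min-set lies on a loop, so it is a rational number whose denominator divides
  some \<open>R\<^sup>p - 1\<close> and is therefore coprime to \<open>R\<close>.\<close>

lemma min_set_denominator:
  assumes "is_min_set M" "t \<in> M"
  shows "\<exists>q k::int. coprime R q \<and> q \<noteq> 0 \<and> of_int q * t = of_int k"
proof -
  obtain w where w: "w \<noteq> []" "g_word R w t = t"
    using min_set_reachable[OF assms assms(2)] by blast
  obtain k :: int where "of_int R ^ length w * t = t - of_int k"
    using g_word_integer_part[of w t] w by auto
  then have "of_int (R ^ length w - 1) * t = of_int (- k)" by (simp add: left_diff_distrib)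
  moreover have "coprime R (R ^ length w - 1)"
  proof -
    have "coprime (R ^ length w) (R ^ length w - 1)" by simp
    then show ?thesis by (rule coprime_divisors[rotated 2]) (use w(1) in auto)
  qed
  moreover have "1 < R ^ length w"
    using w(1) R_ge_2 by (intro one_less_power) auto
  then have "R ^ length w - 1 \<noteq> 0" by simp
  ultimately show ?thesis by blast
qed

lemma min_set_possible_congruent:
  assumes M: "is_min_set M" "t \<in> M"
    and l: "l \<in> L" "possible R B \<alpha> t l" and l': "l' \<in> L" "possible R B \<alpha> t l'"
  shows "R dvd l' - l"
proof -
  obtain q k q' k' :: int where q: "coprime R q" "of_int q * g_map R l t = of_int k"
    and q': "coprime R q'" "of_int q' * g_map R l' t = of_int k'"
    using min_set_denominator[OF M(1) min_set_step[OF M l]]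
      min_set_denominator[OF M(1) min_set_step[OF M l']] by blast
  have "of_int (l' - l) = of_int R * (g_map R l t - g_map R l' t)"
    using g_map_inverse[of l t] g_map_inverse[of l' t] by (simp add: right_diff_distrib)
  then have "of_int ((l' - l) * (q * q'))
      = of_int R * (g_map R l t - g_map R l' t) * (of_int q * of_int q')" by simp
  also have "\<dots> = of_int R * (of_int q' * (of_int q * g_map R l t) - of_int q * (of_int q' * g_map R l' t))"
    by (simp add: algebra_simps)
  also have "\<dots> = of_int (R * (q' * k - q * k'))" unfolding q(2) q'(2) by simp
  finally have "(l' - l) * (q * q') = R * (q' * k - q * k')" by (simp only: of_int_eq_iff)
  then have "R dvd (l' - l) * (q * q')" by simp
  then show ?thesis using q(1) q'(1) by (simp add: coprime_dvd_mult_left_iff)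
qed

text \<open>At the integer \<open>k\<close>, the digits \<open>l \<equiv> k\<close> modulo \<open>R\<close> lead to integers, where \<open>m\<^sub>B = 1\<close>; the quadrature
  identity at \<open>k\<close> bounds their weights.\<close>

lemma residue_class_weight_le_1: "(\<Sum>l | l \<in> L \<and> R dvd l - k. (cmod (\<alpha> l))\<^sup>2) \<le> 1"
proof -
  have m: "m_fun B (g_map R l (of_int k)) = 1" if "R dvd l - k" for l
  proof -
    obtain j where "l - k = R * j" using \<open>R dvd l - k\<close> unfolding dvd_def by blast
    then have "real_of_int k - real_of_int l = of_int R * of_int (- j)"
      by (simp flip: of_int_mult of_int_minus of_int_diff)
    then have "g_map R l (of_int k) = of_int (- j)"
      using R_pos by (simp add: g_map_def)
    then show ?thesis using m_fun_dual_point[OF dual_point_of_int[of "- j"]] by simp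
  qed
  have "(\<Sum>l | l \<in> L \<and> R dvd l - k. (cmod (\<alpha> l))\<^sup>2)
      = (\<Sum>l | l \<in> L \<and> R dvd l - k. (cmod (\<alpha> l * m_fun B (g_map R l (of_int k))))\<^sup>2)"
    by (intro sum.cong) (auto simp: m)
  also have "\<dots> \<le> (\<Sum>l\<in>L. (cmod (\<alpha> l * m_fun B (g_map R l (of_int k))))\<^sup>2)"
    using finite_L by (intro sum_mono2) auto
  finally show ?thesis using quadrature_mirror by simp
qed

text \<open>Equality in the triangle inequality: an average of unimodular numbers has modulus one only
  when they agree, and here one of them is \<open>e\<^sub>0 = 1\<close>.\<close>

lemma dual_pointI:
  assumes "cmod (m_fun B t) \<ge> 1"
  shows "dual_point t"
proof -
  define m where "m = m_fun B t"
  define z where "z b = fourier_exp (of_int b) t" for b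
  have sum_z: "(\<Sum>b\<in>B. z b) = of_nat (card B) * m"
    using card_B_pos by (simp add: m_def m_fun_def z_def)
  have "(cmod (z b - m))\<^sup>2 = 1 - 2 * Re (z b * cnj m) + (cmod m)\<^sup>2" for b
  proof -
    have "(cmod (u - m))\<^sup>2 = (cmod u)\<^sup>2 - 2 * Re (u * cnj m) + (cmod m)\<^sup>2" for u
      unfolding cmod_power2 by (simp add: algebra_simps power2_eq_square)
    from this[of "z b"] show ?thesis by (simp add: z_def)
  qed
  then have "(\<Sum>b\<in>B. (cmod (z b - m))\<^sup>2)
      = card B - 2 * Re ((\<Sum>b\<in>B. z b) * cnj m) + card B * (cmod m)\<^sup>2"
    by (simp add: sum.distrib sum_subtractf sum_distrib_left sum_distrib_right)
  also have "Re ((\<Sum>b\<in>B. z b) * cnj m) = card B * (cmod m)\<^sup>2"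
    unfolding sum_z mult.assoc complex_norm_square[symmetric] by simp
  finally have "(\<Sum>b\<in>B. (cmod (z b - m))\<^sup>2) = card B * (1 - (cmod m)\<^sup>2)"
    by (simp add: algebra_simps)
  moreover have "(cmod m)\<^sup>2 \<ge> 1" using assms by (simp add: m_def one_le_power)
  ultimately have "(\<Sum>b\<in>B. (cmod (z b - m))\<^sup>2) \<le> 0"
    by (simp add: mult_nonneg_nonpos)
  then have "(\<Sum>b\<in>B. (cmod (z b - m))\<^sup>2) = 0" by (intro antisym sum_nonneg) auto
  then have "z b = m" if "b \<in> B" for b
    using that finite_B by (simp add: sum_nonneg_eq_0_iff)
  moreover from this[OF zero_in_B] have "m = 1" by (simp add: z_def)
  ultimately show ?thesis by (simp add: dual_point_def z_def)
qed

text \<open>All possible digits at a point of a min-set lie in one residue class modulo \<open>R\<close>, on which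
  \<open>m\<^sub>B \<circ> g\<^sub>l\<close> has a constant value.  The total weight of the class is at most one, whereas the
  quadrature identity makes its product with the square of that value equal to one.\<close>

lemma min_set_dual_point:
  assumes M: "is_min_set M" "t \<in> M"
  shows "dual_point t"
proof (rule dual_pointI)
  obtain w where w: "w \<noteq> []" "admissible t w" "g_word R w t = t"
    using min_set_reachable[OF M M(2)] by blast
  \<comment> \<open>The last step of a loop at \<open>t\<close> enters \<open>t\<close> from a point \<open>s\<close> of the min-set.\<close>
  obtain u l where ul: "w = u @ [l]" using w(1) by (cases w rule: rev_cases) auto
  define s where "s = g_word R u t"
  have s: "s \<in> M" "l \<in> L" "possible R B \<alpha> s l" "t = g_map R l s"
    using w admissible_min_set[OF M, of u] by (auto simp: ul s_def admissible_append)
  have eq: "m_fun B (g_map R l' s) = m_fun B t" if "R dvd l' - l" for l'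
  proof -
    obtain j where "l' - l = R * j" using \<open>R dvd l' - l\<close> unfolding dvd_def by blast
    then have "real_of_int l' = real_of_int l + of_int R * of_int j"
      by (metis add.commute diff_add_cancel of_int_add of_int_mult)
    then have "g_map R l' s = t + of_int (- j)"
      using R_pos unfolding s(4) by (simp add: g_map_def field_simps)
    then show ?thesis using m_fun_add_dual_point[OF dual_point_of_int[of "- j"]] by simp
  qed
  have "1 = (\<Sum>l'\<in>L. (cmod (\<alpha> l' * m_fun B (g_map R l' s)))\<^sup>2)"
    using quadrature_mirror by simp
  also have "\<dots> = (\<Sum>l' | l' \<in> L \<and> R dvd l' - l. (cmod (\<alpha> l' * m_fun B (g_map R l' s)))\<^sup>2)"
    using finite_L min_set_possible_congruent[OF M(1) s(1) s(2) s(3)]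
    by (intro sum.mono_neutral_right) (auto simp: possible_def)
  also have "\<dots> = (cmod (m_fun B t))\<^sup>2 * (\<Sum>l' | l' \<in> L \<and> R dvd l' - l. (cmod (\<alpha> l'))\<^sup>2)"
    by (simp add: eq norm_mult power_mult_distrib sum_distrib_left mult.commute)
  also have "\<dots> \<le> (cmod (m_fun B t))\<^sup>2"
    using mult_left_mono[OF residue_class_weight_le_1[of l]] by fastforce
  finally show "cmod (m_fun B t) \<ge> 1"
    by (intro power2_le_imp_le[of 1]) auto
qed

lemma min_set_possible_weight:
  assumes M: "is_min_set M" "t \<in> M"
  shows "(\<Sum>l | l \<in> L \<and> possible R B \<alpha> t l. (cmod (\<alpha> l))\<^sup>2) = 1"
proof -
  have "(\<Sum>l | l \<in> L \<and> possible R B \<alpha> t l. (cmod (\<alpha> l))\<^sup>2)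
      = (\<Sum>l | l \<in> L \<and> possible R B \<alpha> t l. (cmod (\<alpha> l * m_fun B (g_map R l t)))\<^sup>2)"
    using m_fun_dual_point[OF min_set_dual_point[OF M(1) min_set_step[OF M]]] by (intro sum.cong) auto
  also have "\<dots> = (\<Sum>l\<in>L. (cmod (\<alpha> l * m_fun B (g_map R l t)))\<^sup>2)"
    using finite_L by (intro sum.mono_neutral_left) (auto simp: possible_def)
  finally show ?thesis using quadrature_mirror by simp
qed

text \<open>If \<open>\<langle>e\<^sub>s, e\<^sub>t\<rangle> \<noteq> 0\<close>, then any digit possible at \<open>t\<close> is possible at \<open>s\<close>, and it leads to a pair with
  nonzero inner product again, whose distance is smaller by the factor \<open>R\<close>.  Min-sets being
  finite, this descent has to stop.\<close>

lemma min_set_orthogonal: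
  assumes M: "is_min_set M" "is_min_set M'" and st: "s \<in> M" "t \<in> M'" "s \<noteq> t"
  shows "coeff (fourier_exp s) t = 0"
proof (rule ccontr)
  assume nz: "coeff (fourier_exp s) t \<noteq> 0"
  define A where "A = {(s, t). s \<in> M \<and> t \<in> M' \<and> s \<noteq> t \<and> coeff (fourier_exp s) t \<noteq> 0}"
  have "finite A"
    by (rule finite_subset[OF _ finite_cartesian_product[OF min_set_finite[OF M(1)] min_set_finite[OF M(2)]]])
       (auto simp: A_def)
  moreover have "A \<noteq> {}" using nz st by (auto simp: A_def)
  ultimately have "\<exists>x. is_arg_min (\<lambda>(s, t). \<bar>s - t\<bar>) (\<lambda>x. x \<in> A) x"
    by (rule ex_is_arg_min_if_finite)
  then obtain a b where ab: "(a, b) \<in> A" "\<And>s t. (s, t) \<in> A \<Longrightarrow> \<bar>a - b\<bar> \<le> \<bar>s - t\<bar>"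
    unfolding is_arg_min_linorder by auto
  have a: "a \<in> M" "b \<in> M'" "a \<noteq> b" "coeff (fourier_exp a) b \<noteq> 0" using ab(1) by (auto simp: A_def)
  obtain l where l: "l \<in> L" "possible R B \<alpha> b l" using possible_exists by blast
  have b': "g_map R l b \<in> M'" by (rule min_set_step[OF M(2) a(2) l])
  have "coeff (cuntz_adj l (fourier_exp a)) (g_map R l b) = cnj (\<alpha> l) * coeff (fourier_exp a) b"
    using coeff_cuntz_adj[OF fourier_exp_in_L2 min_set_dual_point[OF M(2) b']] by (simp add: g_map_inverse)
  then have "cnj (\<alpha> l) * m_fun B (g_map R l a) * coeff (fourier_exp (g_map R l a)) (g_map R l b)
      = cnj (\<alpha> l) * coeff (fourier_exp a) b"
    unfolding cuntz_adj_fourier_exp by (subst (asm) coeff_scale) simp_all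
  moreover have "cnj (\<alpha> l) * coeff (fourier_exp a) b \<noteq> 0"
    using l(2) a(4) by (simp add: possible_def)
  ultimately have nz': "cnj (\<alpha> l) * m_fun B (g_map R l a) * coeff (fourier_exp (g_map R l a)) (g_map R l b) \<noteq> 0"
    by metis
  then have "possible R B \<alpha> a l" by (simp add: possible_def)
  then have a': "g_map R l a \<in> M" by (rule min_set_step[OF M(1) a(1) l(1)])
  have d: "g_map R l a - g_map R l b = (a - b) / of_int R"
    by (simp add: g_map_def diff_divide_distrib)
  then have "g_map R l a \<noteq> g_map R l b" using a(3) R_pos by auto
  then have "(g_map R l a, g_map R l b) \<in> A" using nz' a' b' by (auto simp: A_def)
  then have "\<bar>a - b\<bar> \<le> \<bar>a - b\<bar> / of_int R" using ab(2) d R_pos by (metis abs_divide abs_of_pos)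
  moreover have "\<bar>a - b\<bar> / of_int R \<le> \<bar>a - b\<bar> / 2"
    using R_ge_2 by (intro divide_left_mono) auto
  ultimately have "\<bar>a - b\<bar> \<le> \<bar>a - b\<bar> / 2" by (rule order_trans)
  then show False using a(3) by simp
qed

text \<open>Following a path inside a min-set only multiplies a coefficient by the weight of the path, since
  \<open>S\<^sub>l e\<^sub>s = \<alpha>\<^sub>l e\<^sub>t\<close> for \<open>s = g\<^sub>l(t)\<close>.\<close>

lemma coeff_cuntz_word_admissible:
  assumes M: "is_min_set M" and f: "f \<in> L2_space \<mu>"
  shows "t \<in> M \<Longrightarrow> admissible t w \<Longrightarrow>
    coeff (cuntz_word w f) (g_word R w t) = cnj (word_weight \<alpha> w) * coeff f t"
  using f
proof (induction w arbitrary: t f)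
  case (Cons l w)
  then have l: "g_map R l t \<in> M" using min_set_step[OF M] by auto
  have "coeff (cuntz_word w (cuntz_adj l f)) (g_word R w (g_map R l t))
      = cnj (word_weight \<alpha> w) * coeff (cuntz_adj l f) (g_map R l t)"
    using Cons.prems by (intro Cons.IH l) auto
  also have "coeff (cuntz_adj l f) (g_map R l t) = cnj (\<alpha> l) * coeff f t"
    using coeff_cuntz_adj[OF Cons.prems(3) min_set_dual_point[OF M l], of l] by (simp add: g_map_inverse)
  finally show ?case by simp
qed simp

text \<open>The digit \<open>0\<close>, of weight one, fixes the point \<open>0\<close> and so exhausts the quadrature identity there.\<close>

lemma min_set_zero: "is_min_set {0}"
proof -
  have "g_map R l 0 = 0" if l: "l \<in> L" "possible R B \<alpha> 0 l" for l
  proof (rule ccontr)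
    assume "g_map R l 0 \<noteq> 0"
    then have "l \<noteq> 0" by (auto simp: g_map_def)
    have "(\<Sum>l\<in>{0, l}. (cmod (\<alpha> l * m_fun B (g_map R l 0)))\<^sup>2) \<le> 1"
      using sum_mono2[OF finite_L, of "{0, l}" "\<lambda>l. (cmod (\<alpha> l * m_fun B (g_map R l 0)))\<^sup>2"]
        zero_in_L l(1) quadrature_mirror[of 0] by auto
    moreover have "g_map R 0 0 = 0" by (simp add: g_map_def)
    moreover have "m_fun B 0 = 1" using m_fun_dual_point[OF dual_point_of_int[of 0]] by simp
    ultimately show False
      using \<open>l \<noteq> 0\<close> l(2) alpha_0 by (simp add: possible_def)
  qed
  then have "invariant_set R B L \<alpha> {0}" unfolding invariant_set_def by auto
  moreover have "\<not> invariant_set R B L \<alpha> M'" if "M' \<subset> {0}" for M'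
    using that unfolding invariant_set_def by auto
  ultimately show ?thesis unfolding min_set_def by auto
qed

end

section \<open>Words, loops and the Bessel inequality\<close>

context affine_frame
begin

abbreviation is_cycle_word :: "real \<Rightarrow> int list \<Rightarrow> bool" where
  "is_cycle_word \<equiv> cycle_word R B L \<alpha>"

abbreviation \<Omega> :: "real \<Rightarrow> int list set" where
  "\<Omega> \<equiv> Omega R B L \<alpha>"

lemma cycle_word_iff:
  "is_cycle_word t w \<longleftrightarrow> w \<noteq> [] \<and> admissible t w \<and> g_word R w t = t \<and>
     (\<forall>k < length w - 1. g_word R (take (Suc k) w) t \<noteq> t)"
  unfolding cycle_word_def admissible_iff by auto

lemma loop_ends_with_cycle_word:
  "w \<noteq> [] \<Longrightarrow> admissible t w \<Longrightarrow> g_word R w t = t \<Longrightarrow> \<exists>u v. w = u @ v \<and> is_cycle_word t v"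
proof (induction "length w" arbitrary: w rule: less_induct)
  case less
  show ?case
  proof (cases "is_cycle_word t w")
    case True
    then show ?thesis by (metis append_Nil)
  next
    case False
    then obtain k where k: "k < length w - 1" "g_word R (take (Suc k) w) t = t"
      using less.prems unfolding cycle_word_iff by auto
    define x y where "x = take (Suc k) w" and "y = drop (Suc k) w"
    have w: "w = x @ y" by (simp add: x_def y_def)
    have "y \<noteq> []" "length y < length w" using k by (auto simp: y_def)
    moreover have "g_word R x t = t" using k(2) by (simp add: x_def)
    then have "admissible t y" "g_word R y t = t"
      using less.prems(2,3) unfolding w by (auto simp: admissible_append)
    ultimately obtain u v where "y = u @ v" "is_cycle_word t v" using less.hyps by blast
    then show ?thesis unfolding w by (metis append.assoc)
  qed
qed

lemma cycle_words_prefix_free: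
  assumes "is_cycle_word t w" "is_cycle_word t (w @ x)"
  shows "x = []"
proof (rule ccontr)
  assume x: "x \<noteq> []"
  have w: "w \<noteq> []" "g_word R w t = t" using assms(1) unfolding cycle_word_iff by auto
  then have "length w - 1 < length (w @ x) - 1" using x by (cases w) auto
  then have "g_word R (take (Suc (length w - 1)) (w @ x)) t \<noteq> t"
    using assms(2) unfolding cycle_word_iff by blast
  then show False using w by simp
qed

lemma finite_words_length_eq: "finite {w. set w \<subseteq> L \<and> length w = n}"
  by (rule finite_lists_length_eq[OF finite_L])

lemma finite_words_length_le: "finite {w. set w \<subseteq> L \<and> length w \<le> n}"
  by (rule finite_lists_length_le[OF finite_L])

text \<open>Along a min-set, \<open>\<bar>\<alpha>\<^sub>l\<bar>\<^sup>2\<close> are the transition probabilities of a random walk.\<close>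

lemma admissible_weight:
  assumes M: "is_min_set M"
  shows "t \<in> M \<Longrightarrow> (\<Sum>w | admissible t w \<and> length w = n. (cmod (word_weight \<alpha> w))\<^sup>2) = 1"
proof (induction n arbitrary: t)
  case 0
  have "{w. admissible t w \<and> w = []} = {[]}" by auto
  then show ?case by simp
next
  case (Suc n)
  let ?W = "\<lambda>t n. {w. admissible t w \<and> length w = n}"
  let ?L = "{l \<in> L. possible R B \<alpha> t l}"
  have fin: "finite (?W t n)" for t
    by (rule finite_subset[OF _ finite_words_length_eq[of n]]) (auto dest: admissible_letters)
  have "?W t (Suc n) = (\<lambda>(l, w). l # w) ` (SIGMA l:?L. ?W (g_map R l t) n)"
    by (force simp: length_Suc_conv)
  moreover have "inj_on (\<lambda>(l, w). l # w) (SIGMA l:?L. ?W (g_map R l t) n)" by (auto simp: inj_on_def)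
  ultimately have "(\<Sum>w\<in>?W t (Suc n). (cmod (word_weight \<alpha> w))\<^sup>2)
      = (\<Sum>(l, w)\<in>(SIGMA l:?L. ?W (g_map R l t) n). (cmod (\<alpha> l))\<^sup>2 * (cmod (word_weight \<alpha> w))\<^sup>2)"
    by (simp add: sum.reindex case_prod_unfold norm_mult power_mult_distrib)
  also have "\<dots> = (\<Sum>l\<in>?L. (cmod (\<alpha> l))\<^sup>2 * (\<Sum>w\<in>?W (g_map R l t) n. (cmod (word_weight \<alpha> w))\<^sup>2))"
    using finite_L fin by (subst sum.Sigma[symmetric]) (auto simp: sum_distrib_left)
  also have "\<dots> = (\<Sum>l\<in>?L. (cmod (\<alpha> l))\<^sup>2)"
    using Suc.IH min_set_step[OF M Suc.prems] by (intro sum.cong) auto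
  finally show ?case using min_set_possible_weight[OF M Suc.prems] by simp
qed

text \<open>Kraft inequality: a prefix-free set of words is a family of disjoint events for that random walk.\<close>

lemma prefix_free_weight_le_1:
  assumes M: "is_min_set M"
  shows "t \<in> M \<Longrightarrow> finite A \<Longrightarrow> (\<And>w. w \<in> A \<Longrightarrow> admissible t w \<and> length w \<le> n) \<Longrightarrow>
    (\<And>w x. w \<in> A \<Longrightarrow> w @ x \<in> A \<Longrightarrow> x = []) \<Longrightarrow> (\<Sum>w\<in>A. (cmod (word_weight \<alpha> w))\<^sup>2) \<le> 1"
proof (induction n arbitrary: t A)
  case 0
  then have "A \<subseteq> {[]}" by auto
  then have "A = {} \<or> A = {[]}" by auto
  then show ?case by auto
next
  case (Suc n)
  show ?case
  proof (cases "[] \<in> A")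
    case True
    then have "A = {[]}" using Suc.prems(4)[OF True] by auto
    then show ?thesis by simp
  next
    case False
    let ?L = "{l \<in> L. possible R B \<alpha> t l}"
    let ?A = "\<lambda>l. {w. l # w \<in> A}"
    have fin: "finite (?A l)" for l
      using Suc.prems(2) by (rule finite_subset[rotated, OF finite_imageI[of _ tl]]) force
    have A: "A = (\<lambda>(l, w). l # w) ` (SIGMA l:?L. ?A l)"
    proof (intro set_eqI iffI)
      fix w assume "w \<in> A"
      moreover from this False obtain l v where "w = l # v" by (cases w) auto
      ultimately show "w \<in> (\<lambda>(l, w). l # w) ` (SIGMA l:?L. ?A l)"
        using Suc.prems(3)[of w] by force
    qed auto
    have "inj_on (\<lambda>(l, w). l # w) (SIGMA l:?L. ?A l)" by (auto simp: inj_on_def)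
    from this A have "(\<Sum>w\<in>A. (cmod (word_weight \<alpha> w))\<^sup>2)
        = (\<Sum>(l, w)\<in>(SIGMA l:?L. ?A l). (cmod (\<alpha> l))\<^sup>2 * (cmod (word_weight \<alpha> w))\<^sup>2)"
      by (rule sum.reindex_cong) (auto simp: norm_mult power_mult_distrib)
    also have "\<dots> = (\<Sum>l\<in>?L. (cmod (\<alpha> l))\<^sup>2 * (\<Sum>w\<in>?A l. (cmod (word_weight \<alpha> w))\<^sup>2))"
      using finite_L fin by (subst sum.Sigma[symmetric]) (auto simp: sum_distrib_left)
    also have "\<dots> \<le> (\<Sum>l\<in>?L. (cmod (\<alpha> l))\<^sup>2 * 1)"
    proof (intro sum_mono mult_left_mono)
      fix l assume l: "l \<in> ?L"
      show "(\<Sum>w\<in>?A l. (cmod (word_weight \<alpha> w))\<^sup>2) \<le> 1"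
      proof (rule Suc.IH[of "g_map R l t"])
        show "g_map R l t \<in> M" using min_set_step[OF M Suc.prems(1)] l by auto
        show "admissible (g_map R l t) w \<and> length w \<le> n" if "w \<in> ?A l" for w
          using Suc.prems(3)[of "l # w"] that by auto
        show "x = []" if "w \<in> ?A l" "w @ x \<in> ?A l" for w x
          using Suc.prems(4)[of "l # w" x] that by auto
      qed (rule fin)
    qed auto
    finally show ?thesis using min_set_possible_weight[OF M Suc.prems(1)] by simp
  qed
qed

lemma cycle_words_weight_le_1:
  assumes M: "is_min_set M" "t \<in> M" and A: "finite A" "\<And>w. w \<in> A \<Longrightarrow> is_cycle_word t w"
  shows "(\<Sum>w\<in>A. (cmod (word_weight \<alpha> w))\<^sup>2) \<le> 1"
proof (rule prefix_free_weight_le_1[OF M A(1)])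
  show "admissible t w \<and> length w \<le> Max (length ` A)" if "w \<in> A" for w
    using A that unfolding cycle_word_iff by auto
  show "x = []" if "w \<in> A" "w @ x \<in> A" for w x
    using cycle_words_prefix_free A(2) that by blast
qed

lemma finite_Omega_le: "finite {u \<in> \<Omega> t. length u \<le> n}"
  by (rule finite_subset[OF _ finite_words_length_le[of n]]) (auto simp: Omega_def)

text \<open>A word in \<open>\<Omega>(t)\<close> followed by an admissible path starting at \<open>t\<close> is determined by the total word
  and the end point of the path: two such decompositions differ by a loop at \<open>t\<close>, and words of
  \<open>\<Omega>(t)\<close> do not end in a loop.  Thus, the coefficients of \<open>f\<close> attached to words of \<open>\<Omega>(t)\<close> of length at
  most \<open>n\<close> can be spread, without overlap, over the coefficients of the functions \<open>S\<^sub>w\<^sup>* f\<close>,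
  \<open>\<bar>w\<bar> = n\<close>, at the points of the min-set.\<close>

lemma Omega_coeff_le:
  assumes M: "is_min_set M" "t \<in> M" and f: "f \<in> L2_space \<mu>"
  shows "(\<Sum>u | u \<in> \<Omega> t \<and> length u \<le> n. (cmod (coeff (cuntz_word u f) t))\<^sup>2)
    \<le> (\<Sum>w | set w \<subseteq> L \<and> length w = n. \<Sum>s\<in>M. (cmod (coeff (cuntz_word w f) s))\<^sup>2)"
proof -
  let ?U = "{u. u \<in> \<Omega> t \<and> length u \<le> n}"
  let ?V = "\<lambda>m. {v. admissible t v \<and> length v = m}"
  let ?W = "{w. set w \<subseteq> L \<and> length w = n}"
  define P where "P = (SIGMA u:?U. ?V (n - length u))"
  define h where "h = (\<lambda>(u, v). (u @ v, g_word R v t))"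
  let ?x = "\<lambda>(w, s). (cmod (coeff (cuntz_word w f) s))\<^sup>2"
  have fV: "finite (?V m)" for m
    by (rule finite_subset[OF _ finite_words_length_eq[of m]]) (auto dest: admissible_letters)
  have no_overlap: "x = []" if u: "u \<in> \<Omega> t" "u = u' @ x"
    and v: "admissible t (x @ v)" "g_word R (x @ v) t = g_word R v t" for u u' x v
  proof (rule ccontr)
    assume "x \<noteq> []"
    moreover have "g_word R x t = t" using g_word_inject[of v "g_word R x t" t] v(2) by simp
    ultimately obtain y z where "x = y @ z" "is_cycle_word t z"
      using loop_ends_with_cycle_word[of x t] v(1) by (auto simp: admissible_append)
    then have "u = (u' @ y) @ z" "is_cycle_word t z" using u(2) by auto
    then show False using u(1) unfolding Omega_def by blast
  qed
  have inj: "inj_on h P"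
  proof (rule inj_onI)
    fix p q assume pq: "p \<in> P" "q \<in> P" "h p = h q"
    obtain u v u' v' where uv: "p = (u, v)" "q = (u', v')" by (metis surj_pair)
    then have p: "p = (u, v)" "q = (u', v')" "u \<in> \<Omega> t" "u' \<in> \<Omega> t"
      "admissible t v" "admissible t v'" "u @ v = u' @ v'" "g_word R v t = g_word R v' t"
      using pq unfolding P_def h_def by simp_all
    from p(7) obtain x where "u = u' @ x \<and> x @ v = v' \<or> u @ x = u' \<and> v = x @ v'"
      unfolding append_eq_append_conv2 by blast
    then show "p = q"
    proof
      assume x: "u = u' @ x \<and> x @ v = v'"
      then have "admissible t (x @ v)" "g_word R (x @ v) t = g_word R v t"
        using p(6) p(8) by metis+
      then have "x = []" using no_overlap p(3) x by blast
      with x show ?thesis unfolding p(1,2) by simp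
    next
      assume x: "u @ x = u' \<and> v = x @ v'"
      then have "admissible t (x @ v')" "g_word R (x @ v') t = g_word R v' t"
        using p(5) p(8) by metis+
      then have "x = []" using no_overlap[of u' u x v'] p(4) x by blast
      with x show ?thesis unfolding p(1,2) by simp
    qed
  qed
  have "(\<Sum>u\<in>?U. (cmod (coeff (cuntz_word u f) t))\<^sup>2)
      = (\<Sum>u\<in>?U. \<Sum>v\<in>?V (n - length u). (cmod (word_weight \<alpha> v))\<^sup>2 * (cmod (coeff (cuntz_word u f) t))\<^sup>2)"
    by (simp add: sum_distrib_right[symmetric] admissible_weight[OF M])
  also have "\<dots> = (\<Sum>u\<in>?U. \<Sum>v\<in>?V (n - length u). ?x (h (u, v)))"
    by (intro sum.cong refl)
       (simp add: h_def cuntz_word_append coeff_cuntz_word_admissible[OF M(1) cuntz_word_L2[OF f] M(2)] norm_mult power_mult_distrib)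
  also have "\<dots> = (\<Sum>p\<in>P. ?x (h p))"
    unfolding P_def using finite_Omega_le fV by (subst sum.Sigma) (auto simp: case_prod_unfold)
  also have "\<dots> = (\<Sum>p\<in>h ` P. ?x p)"
    using inj by (simp add: sum.reindex)
  also have "\<dots> \<le> (\<Sum>p\<in>?W \<times> M. ?x p)"
  proof (rule sum_mono2)
    show "finite (?W \<times> M)" using finite_words_length_eq min_set_finite[OF M(1)] by simp
    show "h ` P \<subseteq> ?W \<times> M"
      unfolding P_def h_def
      by (auto simp: Omega_def dest: subsetD[OF admissible_letters] intro: admissible_min_set[OF M])
  qed auto
  finally show ?thesis by (simp add: sum.cartesian_product)
qed

end

section \<open>The defect of the frame\<close>

locale affine_frame_choice = affine_frame +
  fixes c :: "real set \<Rightarrow> real"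
  assumes choice: "\<And>M. min_set R B L \<alpha> M \<Longrightarrow> c M \<in> M"
begin

definition frame_index :: "(real set \<times> int list) set" where
  "frame_index = (SIGMA M:{M. is_min_set M}. \<Omega> (c M))"

text \<open>For \<open>i\<close> in the index set, this is the square of the inner product of \<open>f\<close> with the \<open>i\<close>-th function of the family,
  by \<open>coeff_cuntz_word\<close>.\<close>

definition term_sq :: "(real \<Rightarrow> complex) \<Rightarrow> real set \<times> int list \<Rightarrow> real" where
  "term_sq f i = (cmod (coeff (cuntz_word (snd i) f) (c (fst i))))\<^sup>2"

lemma term_sq_nonneg [simp]: "term_sq f i \<ge> 0"
  by (simp add: term_sq_def)

text \<open>Distinct points of the union of all min-sets give orthogonal exponentials.  So the Bessel
  inequality for each \<open>S\<^sub>w\<^sup>* f\<close> with \<open>\<bar>w\<bar> = n\<close>, summed over these words, bounds the coefficients that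
  were spread over them.\<close>

lemma term_sq_finite_bessel:
  assumes f: "f \<in> L2_space \<mu>" and J: "finite J" "J \<subseteq> frame_index"
  shows "(\<Sum>i\<in>J. term_sq f i) \<le> norm_sq f"
proof -
  define \<M> where "\<M> = fst ` J"
  define n where "n = Max (insert 0 (length ` snd ` J))"
  let ?U = "\<lambda>M. {u. u \<in> \<Omega> (c M) \<and> length u \<le> n}"
  let ?W = "{w. set w \<subseteq> L \<and> length w = n}"
  have fin: "finite \<M>" using J by (simp add: \<M>_def)
  have \<M>: "is_min_set M" if "M \<in> \<M>" for M
    using that J by (auto simp: \<M>_def frame_index_def)
  have "length (snd i) \<le> n" if "i \<in> J" for i
    unfolding n_def using J(1) that by (intro Max_ge) auto
  then have sub: "J \<subseteq> Sigma \<M> ?U"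
    using J(2) by (force simp: frame_index_def \<M>_def)
  have "(\<Sum>i\<in>J. term_sq f i) \<le> (\<Sum>i\<in>Sigma \<M> ?U. term_sq f i)"
    using fin finite_Omega_le by (intro sum_mono2 sub) auto
  also have "\<dots> = (\<Sum>M\<in>\<M>. \<Sum>u\<in>?U M. (cmod (coeff (cuntz_word u f) (c M)))\<^sup>2)"
    using fin finite_Omega_le by (subst sum.Sigma) (auto simp: term_sq_def case_prod_unfold)
  also have "\<dots> \<le> (\<Sum>M\<in>\<M>. \<Sum>w\<in>?W. \<Sum>s\<in>M. (cmod (coeff (cuntz_word w f) s))\<^sup>2)"
    using \<M> choice f by (intro sum_mono Omega_coeff_le) auto
  also have "\<dots> = (\<Sum>w\<in>?W. \<Sum>M\<in>\<M>. \<Sum>s\<in>M. (cmod (coeff (cuntz_word w f) s))\<^sup>2)"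
    by (rule sum.swap)
  also have "\<dots> = (\<Sum>w\<in>?W. \<Sum>s\<in>\<Union>\<M>. (cmod (coeff (cuntz_word w f) s))\<^sup>2)"
    using \<M> min_set_finite min_sets_disjoint
    by (intro sum.cong refl sum.Union_disjoint[symmetric, unfolded comp_def]) auto
  also have "\<dots> \<le> (\<Sum>w\<in>?W. norm_sq (cuntz_word w f))"
  proof (intro sum_mono bessel cuntz_word_L2 f)
    show "finite (\<Union>\<M>)" using fin \<M> min_set_finite by auto
    show "coeff (fourier_exp s) t = 0" if "s \<in> \<Union>\<M>" "t \<in> \<Union>\<M>" "s \<noteq> t" for s t
      using that \<M> min_set_orthogonal by blast
  qed
  also have "\<dots> = norm_sq f" by (rule sum_norm_sq_cuntz_word[OF f])
  finally show ?thesis .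
qed

lemma term_sq_summable: "f \<in> L2_space \<mu> \<Longrightarrow> term_sq f summable_on frame_index"
  by (rule nonneg_bdd_above_summable_on) (auto simp: bdd_above_def intro: term_sq_finite_bessel)

definition energy :: "(real \<Rightarrow> complex) \<Rightarrow> real" where
  "energy f = (\<Sum>\<^sub>\<infinity>i\<in>frame_index. term_sq f i)"

text \<open>The quadratic form of the identity minus the frame operator; the family is a Parseval frame exactly
  when it vanishes.\<close>

definition defect :: "(real \<Rightarrow> complex) \<Rightarrow> real" where
  "defect f = norm_sq f - energy f"

lemma energy_nonneg: "energy f \<ge> 0"
  unfolding energy_def by (rule infsum_nonneg) simp

lemma term_sq_sum_le_energy:
  "f \<in> L2_space \<mu> \<Longrightarrow> finite J \<Longrightarrow> J \<subseteq> frame_index \<Longrightarrow> (\<Sum>i\<in>J. term_sq f i) \<le> energy f"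
  unfolding energy_def by (rule finite_sum_le_infsum[OF term_sq_summable]) auto

lemma defect_nonneg:
  assumes "f \<in> L2_space \<mu>"
  shows "defect f \<ge> 0"
proof -
  have "energy f \<le> norm_sq f"
    unfolding energy_def
    by (rule infsum_le_finite_sums[OF term_sq_summable[OF assms] term_sq_finite_bessel[OF assms]])
  then show ?thesis by (simp add: defect_def)
qed

lemma defect_le_norm_sq: "defect f \<le> norm_sq f"
  unfolding defect_def using energy_nonneg[of f] by simp

lemma defect_scale:
  assumes "f \<in> L2_space \<mu>"
  shows "defect (\<lambda>x. a * f x) = (cmod a)\<^sup>2 * defect f"
proof -
  have "term_sq (\<lambda>x. a * f x) i = (cmod a)\<^sup>2 * term_sq f i" for i
    unfolding term_sq_def cuntz_word_scale
    by (simp add: coeff_scale[OF cuntz_word_L2[OF assms]] norm_mult power_mult_distrib)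
  then have "energy (\<lambda>x. a * f x) = (cmod a)\<^sup>2 * energy f"
    unfolding energy_def infsum_cmult_right'[symmetric] by (intro infsum_cong)
  then show ?thesis unfolding defect_def norm_sq_scale by (simp add: right_diff_distrib)
qed

text \<open>The defect is a nonnegative quadratic form, so its square root is a seminorm; this is the
  triangle inequality in the form in which it is used.\<close>

lemma defect_add_le:
  assumes f: "f \<in> L2_space \<mu>" and h: "h \<in> L2_space \<mu>" and \<epsilon>: "\<epsilon> > 0"
  shows "defect (\<lambda>x. f x + h x) \<le> (1 + \<epsilon>) * defect f + (1 + 1 / \<epsilon>) * defect h"
proof -
  define k where "k = (\<lambda>x. of_real (sqrt \<epsilon>) * f x - of_real (1 / sqrt \<epsilon>) * h x)"
  have L2: "(\<lambda>x. f x + h x) \<in> L2_space \<mu>" "k \<in> L2_space \<mu>"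
    unfolding k_def by (intro L2_add L2_diff L2_scale f h)+
  have "norm_sq k = (1 + \<epsilon>) * norm_sq f + (1 + 1 / \<epsilon>) * norm_sq h - norm_sq (\<lambda>x. f x + h x)"
    unfolding k_def weighted_parallelogram[OF \<epsilon>]
    using L2_integrable_sq[OF f] L2_integrable_sq[OF h] L2_integrable_sq[OF L2(1)] by simp
  moreover have "energy k = (1 + \<epsilon>) * energy f + (1 + 1 / \<epsilon>) * energy h - energy (\<lambda>x. f x + h x)"
  proof -
    have "term_sq k i = (1 + \<epsilon>) * term_sq f i + (1 + 1 / \<epsilon>) * term_sq h i - term_sq (\<lambda>x. f x + h x) i" for i
    proof -
      define w s where "w = snd i" and "s = c (fst i)"
      have "k = (\<lambda>x. of_real (sqrt \<epsilon>) * f x + (- of_real (1 / sqrt \<epsilon>)) * h x)"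
        unfolding k_def by simp
      then have "cuntz_word w k
          = (\<lambda>x. of_real (sqrt \<epsilon>) * cuntz_word w f x + (- of_real (1 / sqrt \<epsilon>)) * cuntz_word w h x)"
        by (simp only: cuntz_word_add cuntz_word_scale)
      then have "coeff (cuntz_word w k) s
          = of_real (sqrt \<epsilon>) * coeff (cuntz_word w f) s - of_real (1 / sqrt \<epsilon>) * coeff (cuntz_word w h) s"
        by (simp only: coeff_add coeff_scale L2_scale cuntz_word_L2 f h) simp
      then show ?thesis
        unfolding term_sq_def w_def[symmetric] s_def[symmetric] cuntz_word_add
          coeff_add[OF cuntz_word_L2[OF f] cuntz_word_L2[OF h]]
        using weighted_parallelogram[OF \<epsilon>] by simp
    qed
    then have eq: "(\<lambda>i. term_sq k i + term_sq (\<lambda>x. f x + h x) i)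
        = (\<lambda>i. (1 + \<epsilon>) * term_sq f i + (1 + 1 / \<epsilon>) * term_sq h i)" by (simp add: fun_eq_iff)
    have "energy k + energy (\<lambda>x. f x + h x)
        = (\<Sum>\<^sub>\<infinity>i\<in>frame_index. term_sq k i + term_sq (\<lambda>x. f x + h x) i)"
      unfolding energy_def by (rule infsum_add[symmetric]) (rule term_sq_summable L2)+
    also have "\<dots> = (1 + \<epsilon>) * energy f + (1 + 1 / \<epsilon>) * energy h"
      unfolding eq energy_def
      by (subst infsum_add)
         (auto simp: infsum_cmult_right' intro!: summable_on_cmult_right term_sq_summable f h)
    finally show ?thesis by simp
  qed
  ultimately have "defect k = (1 + \<epsilon>) * defect f + (1 + 1 / \<epsilon>) * defect h - defect (\<lambda>x. f x + h x)"
    unfolding defect_def by (simp add: algebra_simps)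
  then show ?thesis using defect_nonneg[OF L2(2)] by simp
qed

text \<open>Prepending a digit to a word of \<open>\<Omega>(c)\<close> gives either a word of \<open>\<Omega>(c)\<close> or a cycle word, and the
  cycle words together contribute at most what the empty word contributes.\<close>

lemma energy_cuntz_adj_le:
  assumes f: "f \<in> L2_space \<mu>"
  shows "(\<Sum>l\<in>L. energy (cuntz_adj l f)) \<le> energy f"
proof -
  have finite_bound: "(\<Sum>i\<in>J. \<Sum>l\<in>L. term_sq (cuntz_adj l f) i) \<le> energy f"
    if J: "finite J" "J \<subseteq> frame_index" for J
  proof -
    define e where "e = (\<lambda>((M, w), l). (M, l # w) :: real set \<times> int list)"
    define X where "X = e ` (J \<times> L)"
    have finX: "finite X" using J finite_L by (simp add: X_def)
    have inj: "inj_on e (J \<times> L)" by (auto simp: inj_on_def e_def)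
    have "(\<Sum>i\<in>J. \<Sum>l\<in>L. term_sq (cuntz_adj l f) i) = (\<Sum>p\<in>J \<times> L. term_sq f (e p))"
      by (simp add: sum.cartesian_product case_prod_unfold e_def term_sq_def)
    also have "\<dots> = (\<Sum>i\<in>X. term_sq f i)"
      using inj by (simp add: X_def sum.reindex)
    also have "\<dots> = (\<Sum>i\<in>X \<inter> frame_index. term_sq f i) + (\<Sum>i\<in>X - frame_index. term_sq f i)"
      by (rule sum.Int_Diff[OF finX])
    also have "(\<Sum>i\<in>X - frame_index. term_sq f i) \<le> (\<Sum>i\<in>(\<lambda>M. (M, [])) ` fst ` X. term_sq f i)"
    proof -
      let ?C = "\<lambda>M. {w. (M, w) \<in> X \<and> (M, w) \<notin> frame_index}"
      have finC: "finite (?C M)" for M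
        by (rule finite_subset[OF _ finite_imageI[OF finX, of snd]]) force
      have M: "is_min_set M" if "M \<in> fst ` X" for M
        using that J(2) by (auto simp: X_def e_def frame_index_def)
      have C: "is_cycle_word (c M) v" if vM: "v \<in> ?C M" for M v
      proof -
        obtain l w where v: "v = l # w" "l \<in> L" "(M, w) \<in> frame_index" "v \<notin> \<Omega> (c M)"
          using vM J(2) by (auto simp: X_def e_def frame_index_def)
        then have w: "set w \<subseteq> L" "\<And>u z. w = u @ z \<Longrightarrow> \<not> is_cycle_word (c M) z"
          by (auto simp: frame_index_def Omega_def)
        obtain u z where uz: "v = u @ z" "is_cycle_word (c M) z"
          using v w(1) unfolding Omega_def by auto
        have "u = []"
        proof (rule ccontr)
          assume "u \<noteq> []"
          then have "w = tl u @ z" using uz(1) v(1) by (metis list.sel(3) tl_append2)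
          then show False using w(2) uz(2) by blast
        qed
        with uz show ?thesis by simp
      qed
      have Sigma: "X - frame_index = Sigma (fst ` X) ?C" by force
      have "(\<Sum>i\<in>X - frame_index. term_sq f i) = (\<Sum>(M, w)\<in>Sigma (fst ` X) ?C. term_sq f (M, w))"
        unfolding Sigma by simp
      also have "\<dots> = (\<Sum>M\<in>fst ` X. \<Sum>w\<in>?C M. term_sq f (M, w))"
        by (rule sum.Sigma[symmetric]) (use finX finC in blast)+
      also have "\<dots> = (\<Sum>M\<in>fst ` X. \<Sum>w\<in>?C M. (cmod (word_weight \<alpha> w))\<^sup>2 * term_sq f (M, []))"
      proof (intro sum.cong refl)
        fix M w assume Mw: "M \<in> fst ` X" "w \<in> ?C M"
        have "admissible (c M) w" "g_word R w (c M) = c M"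
          using C[OF Mw(2)] unfolding cycle_word_iff by auto
        then have "coeff (cuntz_word w f) (c M) = cnj (word_weight \<alpha> w) * coeff f (c M)"
          using coeff_cuntz_word_admissible[OF M[OF Mw(1)] f choice[OF M[OF Mw(1)]], of w] by simp
        then show "term_sq f (M, w) = (cmod (word_weight \<alpha> w))\<^sup>2 * term_sq f (M, [])"
          by (simp add: term_sq_def norm_mult power_mult_distrib)
      qed
      also have "\<dots> = (\<Sum>M\<in>fst ` X. (\<Sum>w\<in>?C M. (cmod (word_weight \<alpha> w))\<^sup>2) * term_sq f (M, []))"
        by (simp add: sum_distrib_right)
      also have "\<dots> \<le> (\<Sum>M\<in>fst ` X. 1 * term_sq f (M, []))"
        by (intro sum_mono mult_right_mono cycle_words_weight_le_1[OF M choice[OF M] finC C]) auto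
      also have "\<dots> = (\<Sum>i\<in>(\<lambda>M. (M, [])) ` fst ` X. term_sq f i)"
        by (subst sum.reindex) (auto simp: inj_on_def)
      finally show ?thesis .
    qed
    also have "(\<Sum>i\<in>X \<inter> frame_index. term_sq f i) + (\<Sum>i\<in>(\<lambda>M. (M, [])) ` fst ` X. term_sq f i)
        = (\<Sum>i\<in>X \<inter> frame_index \<union> (\<lambda>M. (M, [])) ` fst ` X. term_sq f i)"
      using finX by (intro sum.union_disjoint[symmetric]) (auto simp: X_def e_def)
    also have "\<dots> \<le> energy f"
    proof (rule term_sq_sum_le_energy[OF f])
      show "X \<inter> frame_index \<union> (\<lambda>M. (M, [])) ` fst ` X \<subseteq> frame_index"
        using J(2) by (auto simp: X_def e_def frame_index_def Omega_def cycle_word_def)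
    qed (use finX in auto)
    finally show ?thesis by simp
  qed
  have "((\<lambda>i. \<Sum>l\<in>A. term_sq (cuntz_adj l f) i) has_sum (\<Sum>l\<in>A. energy (cuntz_adj l f))) frame_index"
    if "finite A" for A
    using that unfolding energy_def
    by induction (auto intro!: has_sum_add has_sum_infsum term_sq_summable cuntz_adj_L2 f)
  from has_sum_le_finite_sums[OF this[OF finite_L] finite_bound] show ?thesis .
qed

end

section \<open>The maximum principle\<close>

context affine_frame
begin

lemma continuous_on_m_fun: "continuous_on A (m_fun B)"
  unfolding m_fun_def[abs_def] by (intro continuous_intros)

text \<open>The function \<open>m\<^sub>B\<close> extends to an entire function with value one at \<open>0\<close>, so its zeros are isolated.\<close>

lemma finite_m_fun_zeros: "finite {x. \<bar>x\<bar> \<le> a \<and> m_fun B x = 0}"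
proof (rule ccontr)
  let ?Z = "{x. \<bar>x\<bar> \<le> a \<and> m_fun B x = 0}"
  assume inf: "infinite ?Z"
  define F where "F z = 1 / of_nat (card B) * (\<Sum>b\<in>B. exp (2 * complex_of_real pi * \<i> * of_int b * z))" for z
  have F: "F (of_real x) = m_fun B x" for x
    by (simp add: F_def m_fun_def fourier_exp_def)
  have "infinite (complex_of_real ` ?Z)"
    using inf by (simp add: finite_image_iff inj_on_def)
  moreover have "complex_of_real ` ?Z \<subseteq> cball 0 a" by auto
  ultimately obtain \<xi> where \<xi>: "\<xi> islimpt (complex_of_real ` ?Z)"
    using compact_cball[of "0::complex" a] unfolding compact_eq_Bolzano_Weierstrass by blast
  have "F 0 = 0"
  proof (rule analytic_continuation[where f=F and w=0 and S=UNIV and \<xi>=\<xi> and U="complex_of_real ` ?Z"])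
    show "F holomorphic_on UNIV" unfolding F_def[abs_def] by (intro holomorphic_intros)
    show "F z = 0" if "z \<in> complex_of_real ` ?Z" for z using that F by auto
  qed (use \<xi> in auto)
  moreover have "F 0 = 1" using card_B_pos by (simp add: F_def)
  ultimately show False by simp
qed

end

context affine_frame_choice
begin

definition exp_defect :: "real \<Rightarrow> real" where
  "exp_defect t = defect (fourier_exp t)"

lemma exp_defect_nonneg: "exp_defect t \<ge> 0"
  unfolding exp_defect_def by (simp add: defect_nonneg)

lemma exp_defect_le_1: "exp_defect t \<le> 1"
  unfolding exp_defect_def using defect_le_norm_sq[of "fourier_exp t"] by simp

text \<open>One step of the operators \<open>S\<^sub>l\<^sup>*\<close> preserves the squared norm and can only lower the frame sum.\<close>

lemma exp_defect_subharmonic: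
  "exp_defect t \<le> (\<Sum>l\<in>L. (cmod (\<alpha> l * m_fun B (g_map R l t)))\<^sup>2 * exp_defect (g_map R l t))"
proof -
  have "exp_defect t \<le> (\<Sum>l\<in>L. defect (cuntz_adj l (fourier_exp t)))"
    using energy_cuntz_adj_le[OF fourier_exp_in_L2[of t]] sum_norm_sq_cuntz_adj[OF fourier_exp_in_L2[of t]]
    unfolding exp_defect_def defect_def by (simp add: sum_subtractf)
  also have "\<dots> = (\<Sum>l\<in>L. (cmod (\<alpha> l * m_fun B (g_map R l t)))\<^sup>2 * exp_defect (g_map R l t))"
    unfolding cuntz_adj_fourier_exp exp_defect_def by (simp add: defect_scale norm_mult)
  finally show ?thesis .
qed

lemma exp_defect_choice:
  assumes "is_min_set M"
  shows "exp_defect (c M) = 0"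
proof -
  have "(M, []) \<in> frame_index"
    using assms by (simp add: frame_index_def Omega_def cycle_word_def)
  then have "term_sq (fourier_exp (c M)) (M, []) \<le> energy (fourier_exp (c M))"
    using term_sq_sum_le_energy[of "fourier_exp (c M)" "{(M, [])}"] by simp
  then have "exp_defect (c M) \<le> 0"
    by (simp add: exp_defect_def defect_def term_sq_def)
  then show ?thesis using exp_defect_nonneg[of "c M"] by simp
qed

lemma continuous_on_exp_defect: "continuous_on A exp_defect"
proof -
  obtain K where K: "K > 0" "AE x in \<mu>. \<bar>x\<bar> \<le> K" using compact_support by blast
  \<comment> \<open>A bound for the distance of \<open>e\<^sub>s\<close> and \<open>e\<^sub>t\<close> in \<open>L\<^sup>2\<close>; it also serves as the parameter \<open>\<epsilon>\<close> of the
    triangle inequality.\<close>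
  define d where "d s t = 2 * pi * K * \<bar>s - t\<bar>" for s t
  have le: "exp_defect s \<le> exp_defect t + 2 * d s t + (d s t)\<^sup>2" for s t
  proof (cases "s = t")
    case False
    then have d: "d s t > 0" using K(1) by (simp add: d_def)
    let ?h = "\<lambda>x. fourier_exp s x - fourier_exp t x"
    have h: "?h \<in> L2_space \<mu>" by (intro L2_diff fourier_exp_in_L2)
    have "norm_sq ?h \<le> (LINT x|\<mu>. (d s t)\<^sup>2)"
    proof (rule integral_mono_AE)
      show "AE x in \<mu>. (cmod (?h x))\<^sup>2 \<le> (d s t)\<^sup>2"
        using K(2)
      proof eventually_elim
        case (elim x)
        have "cmod (?h x) \<le> 2 * pi * \<bar>s - t\<bar> * \<bar>x\<bar>" by (rule fourier_exp_diff_le)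
        also have "\<dots> \<le> 2 * pi * \<bar>s - t\<bar> * K" using elim by (intro mult_left_mono) auto
        finally show ?case by (intro power_mono) (simp_all add: d_def mult_ac)
      qed
    qed (use L2_integrable_sq[OF h] in auto)
    then have hd: "defect ?h \<le> (d s t)\<^sup>2" using defect_le_norm_sq[of ?h] by simp
    have "exp_defect s = defect (\<lambda>x. fourier_exp t x + ?h x)"
      by (simp add: exp_defect_def eta_contract_eq)
    also have "\<dots> \<le> (1 + d s t) * exp_defect t + (1 + 1 / d s t) * defect ?h"
      unfolding exp_defect_def by (rule defect_add_le[OF fourier_exp_in_L2 h d])
    also have "\<dots> \<le> (exp_defect t + d s t * 1) + (1 + 1 / d s t) * (d s t)\<^sup>2"
      using d hd exp_defect_le_1[of t]
      by (intro add_mono mult_left_mono) (auto simp: distrib_right)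
    also have "\<dots> = exp_defect t + 2 * d s t + (d s t)\<^sup>2"
      using d by (simp add: field_simps power2_eq_square)
    finally show ?thesis .
  qed (simp add: d_def)
  have "(exp_defect \<longlongrightarrow> exp_defect t) (at t within A)" for t
  proof -
    have b: "norm (exp_defect s - exp_defect t) \<le> 2 * d s t + (d s t)\<^sup>2" for s
      using le[of s t] le[of t s] by (simp add: d_def abs_minus_commute abs_le_iff)
    have "((\<lambda>s. 2 * d s t + (d s t)\<^sup>2) \<longlongrightarrow> 2 * (2 * pi * K * \<bar>t - t\<bar>) + (2 * pi * K * \<bar>t - t\<bar>)\<^sup>2) (at t within A)"
      unfolding d_def by (intro tendsto_intros)
    then have "((\<lambda>s. 2 * d s t + (d s t)\<^sup>2) \<longlongrightarrow> 0) (at t within A)" by simp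
    then have "((\<lambda>s. exp_defect s - exp_defect t) \<longlongrightarrow> 0) (at t within A)"
      by (rule Lim_null_comparison[OF always_eventually[OF allI[OF b]]])
    then show ?thesis by (rule LIM_zero_cancel)
  qed
  then show ?thesis by (simp add: continuous_on_def)
qed

text \<open>Let \<open>m > 0\<close> be the maximum of the defect on a compact interval that every \<open>g\<^sub>l\<close> maps into itself.
  The set \<open>Z\<close> of maximum points is invariant.  If \<open>t \<in> Z\<close> and the digit \<open>0\<close> were possible all
  along \<open>t, t/R, t/R\<^sup>2, \<dots>\<close>, then by continuity \<open>0\<close> would be a maximum point, but the defect vanishes on the
  min-set \<open>{0}\<close>.  So some \<open>t/R\<^sup>n\<close> is a zero of \<open>m\<^sub>B\<close>; these zeros stay away from \<open>0\<close>, which bounds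
  \<open>n\<close>, and there are finitely many of them.  Hence \<open>Z\<close> is finite and contains a min-set, on
  which the defect has a zero.\<close>

lemma exp_defect_zero: "exp_defect t = 0"
proof -
  \<comment> \<open>The interval contains \<open>t\<close> and all digits, so \<open>\<bar>g\<^sub>l(x)\<bar> \<le> 2a/R \<le> a\<close> on it.\<close>
  define a where "a = \<bar>t\<bar> + (\<Sum>l\<in>L. \<bar>real_of_int l\<bar>)"
  define X where "X = {x. \<bar>x\<bar> \<le> a}"
  have a0: "a \<ge> 0" unfolding a_def by (intro add_nonneg_nonneg sum_nonneg) auto
  have X: "X = {-a..a}" unfolding X_def by auto
  have la: "\<bar>real_of_int l\<bar> \<le> a" if "l \<in> L" for l
  proof -
    have "\<bar>real_of_int l\<bar> \<le> (\<Sum>l\<in>L. \<bar>real_of_int l\<bar>)"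
      using finite_L that by (intro member_le_sum) auto
    then show ?thesis by (simp add: a_def)
  qed
  have gX: "g_map R l x \<in> X" if "x \<in> X" "l \<in> L" for l x
  proof -
    have "\<bar>g_map R l x\<bar> \<le> (a + a) / of_int R"
      using that la[OF that(2)] R_pos unfolding g_map_def X_def
      by (auto simp: abs_divide intro!: divide_right_mono order_trans[OF abs_triangle_ineq4])
    also have "\<dots> \<le> (a + a) / 2" using R_ge_2 a0 by (intro divide_left_mono) auto
    finally show ?thesis by (simp add: X_def)
  qed
  have tX: "t \<in> X" by (auto simp: X_def a_def intro: sum_nonneg)
  obtain t0 where t0: "t0 \<in> X" "\<And>x. x \<in> X \<Longrightarrow> exp_defect x \<le> exp_defect t0"
    using continuous_attains_sup[of X exp_defect] tX continuous_on_exp_defect X by auto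
  define m where "m = exp_defect t0"
  have "m = 0"
  proof (rule ccontr)
    assume "m \<noteq> 0"
    then have m: "m > 0" using exp_defect_nonneg[of t0] by (simp add: m_def)
    define Z where "Z = {x \<in> X. exp_defect x = m}"
    have Z_step: "g_map R l x \<in> Z" if x: "x \<in> Z" and l: "l \<in> L" "possible R B \<alpha> x l" for x l
    proof -
      let ?p = "\<lambda>l. (cmod (\<alpha> l * m_fun B (g_map R l x)))\<^sup>2"
      let ?u = "\<lambda>l. ?p l * (m - exp_defect (g_map R l x))"
      have xX: "x \<in> X" using x by (simp add: Z_def)
      have nn: "?u l \<ge> 0" if "l \<in> L" for l
        using t0(2)[OF gX[OF xX that]] by (simp add: m_def)
      have "(\<Sum>l\<in>L. ?u l) = m * (\<Sum>l\<in>L. ?p l) - (\<Sum>l\<in>L. ?p l * exp_defect (g_map R l x))"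
        by (simp only: right_diff_distrib sum_subtractf sum_distrib_left mult.commute[of m])
      also have "\<dots> = m - (\<Sum>l\<in>L. ?p l * exp_defect (g_map R l x))"
        unfolding quadrature_mirror by simp
      also have "\<dots> \<le> 0"
        using exp_defect_subharmonic[of x] x by (simp add: Z_def)
      finally have "(\<Sum>l\<in>L. ?u l) = 0" by (rule antisym[OF _ sum_nonneg[OF nn]])
      then have "?u l = 0" using sum_nonneg_eq_0_iff[OF finite_L, of ?u] nn l(1) by blast
      then show ?thesis using l(2) gX[OF xX l(1)] by (simp add: Z_def possible_def)
    qed
    have iterate: "x / of_int R ^ n \<in> Z"
      if "x \<in> Z" "\<And>k. k < n \<Longrightarrow> m_fun B (x / of_int R ^ Suc k) \<noteq> 0" for x n
      using that(2)
    proof (induction n)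
      case 0
      show ?case using that(1) by simp
    next
      case (Suc n)
      have g: "g_map R 0 (x / of_int R ^ n) = x / of_int R ^ Suc n"
        by (simp add: g_map_def mult.commute)
      have "x / of_int R ^ n \<in> Z" using Suc by auto
      moreover have "possible R B \<alpha> (x / of_int R ^ n) 0"
        using Suc.prems[of n] unfolding possible_def g by (simp add: alpha_0)
      ultimately show ?case using Z_step zero_in_L g by metis
    qed
    have exists_zero: "\<exists>n. m_fun B (x / of_int R ^ Suc n) = 0" if x: "x \<in> Z" for x
    proof (rule ccontr)
      assume "\<not> ?thesis"
      then have "exp_defect (x / of_int R ^ n) = m" for n
        using iterate[OF x] by (auto simp: Z_def)
      moreover have "(\<lambda>n. x / of_int R ^ n) \<longlonglongrightarrow> 0"
        using R_ge_2 by (intro LIMSEQ_divide_realpow_zero) auto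
      then have "(\<lambda>n. exp_defect (x / of_int R ^ n)) \<longlonglongrightarrow> exp_defect 0"
        using continuous_on_exp_defect[of UNIV]
        by (intro isCont_tendsto_compose[of 0 exp_defect]) (auto simp: continuous_on_eq_continuous_at)
      ultimately have "exp_defect 0 = m" by (simp add: LIMSEQ_const_iff)
      moreover have "exp_defect 0 = 0"
        using exp_defect_choice[OF min_set_zero] choice[OF min_set_zero] by simp
      ultimately show False using m by simp
    qed
    have "\<forall>\<^sub>F x in nhds 0. m_fun B x \<noteq> 0"
    proof -
      have "(m_fun B \<longlongrightarrow> m_fun B 0) (nhds 0)"
        using continuous_on_m_fun[of UNIV] by (simp add: continuous_on_eq_continuous_at isCont_def tendsto_nhds_iff)
      moreover have "m_fun B 0 \<noteq> 0" using m_fun_dual_point[OF dual_point_of_int[of 0]] by simp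
      ultimately show ?thesis by (rule tendsto_imp_eventually_ne)
    qed
    then obtain \<delta> where \<delta>: "\<delta> > 0" "\<And>x. \<bar>x\<bar> < \<delta> \<Longrightarrow> m_fun B x \<noteq> 0"
      unfolding eventually_nhds_metric by (auto simp: dist_real_def)
    obtain n0 where n0: "a / of_int R ^ n0 < \<delta>"
    proof -
      have "(\<lambda>n. a / of_int R ^ n) \<longlonglongrightarrow> 0"
        using R_ge_2 by (intro LIMSEQ_divide_realpow_zero) auto
      from order_tendstoD(2)[OF this \<delta>(1)] show ?thesis
        using that by (auto simp: eventually_sequentially)
    qed
    have "Z \<subseteq> (\<Union>n\<le>n0. (\<lambda>y. of_int R ^ n * y) ` {x. \<bar>x\<bar> \<le> a \<and> m_fun B x = 0})"
    proof
      fix x assume x: "x \<in> Z"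
      obtain n where n: "m_fun B (x / of_int R ^ Suc n) = 0" using exists_zero[OF x] by blast
      have xa: "\<bar>x\<bar> \<le> a" using x by (simp add: Z_def X_def)
      have abs: "\<bar>x / of_int R ^ k\<bar> = \<bar>x\<bar> / of_int R ^ k" for k
        using R_pos by (simp add: abs_divide)
      have "Suc n \<le> n0"
      proof (rule ccontr)
        assume "\<not> ?thesis"
        then have "real_of_int R ^ n0 \<le> of_int R ^ Suc n" using R_ge_2 by (intro power_increasing) auto
        then have "\<bar>x\<bar> / of_int R ^ Suc n \<le> a / of_int R ^ n0"
          using xa R_pos by (intro frac_le) auto
        then have "\<bar>x / of_int R ^ Suc n\<bar> < \<delta>" unfolding abs using n0 by (rule le_less_trans)
        then show False using \<delta>(2) n by blast
      qed
      moreover have "\<bar>x / of_int R ^ Suc n\<bar> \<le> a"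
      proof -
        have "\<bar>x\<bar> / of_int R ^ Suc n \<le> a / 1"
          using xa R_ge_2 by (intro frac_le one_le_power) auto
        then show ?thesis unfolding abs by simp
      qed
      moreover have "x = of_int R ^ Suc n * (x / of_int R ^ Suc n)" using R_pos by simp
      ultimately show "x \<in> (\<Union>n\<le>n0. (\<lambda>y. of_int R ^ n * y) ` {x. \<bar>x\<bar> \<le> a \<and> m_fun B x = 0})"
        using n by blast
    qed
    then have "finite Z"
      by (rule finite_subset) (intro finite_UN_I finite_imageI finite_m_fun_zeros finite_atMost)
    moreover have "invariant_set R B L \<alpha> Z"
      unfolding invariant_set_def using Z_step t0(1) by (auto simp: Z_def m_def)
    ultimately obtain M where M: "M \<subseteq> Z" "is_min_set M"
      using finite_invariant_contains_min_set by blast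
    have "c M \<in> Z" using M choice by blast
    then show False using exp_defect_choice[OF M(2)] m by (simp add: Z_def)
  qed
  then show ?thesis using t0(2)[OF tX] exp_defect_nonneg[of t] by (simp add: m_def)
qed

text \<open>A seminorm that is bounded by the norm and vanishes on a set with dense span vanishes
  everywhere.\<close>

lemma defect_zero:
  assumes "f \<in> L2_space \<mu>"
  shows "defect f = 0"
proof -
  obtain K where K: "K > 0" "AE x in \<mu>. \<bar>x\<bar> \<le> K" using compact_support by blast
  from K(2,1) assms show ?thesis
  proof (induction rule: L2_exponential_induct)
    case (exp t)
    show ?case using exp_defect_zero[of t] by (simp add: exp_defect_def)
  next
    case (add f g)
    then show ?case
      using defect_add_le[of f g 1] defect_nonneg[OF L2_add[of f g]] by simp
  next
    case (scale f a)
    then show ?case by (simp add: defect_scale)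
  next
    case (lim f s)
    have "defect f \<le> 2 * norm_sq (\<lambda>x. s n x - f x)" for n
    proof -
      let ?d = "\<lambda>x. s n x - f x"
      have d: "?d \<in> L2_space \<mu>" using lim by (intro L2_diff) auto
      have "defect f = defect (\<lambda>x. s n x + (-1) * ?d x)" by simp
      also have "\<dots> \<le> (1 + 1) * defect (s n) + (1 + 1 / 1) * defect (\<lambda>x. (-1) * ?d x)"
        using lim d by (intro defect_add_le L2_scale) auto
      also have "\<dots> = 2 * defect ?d"
        using lim unfolding defect_scale[OF d] by simp
      also have "\<dots> \<le> 2 * norm_sq ?d" using defect_le_norm_sq by simp
      finally show ?thesis .
    qed
    moreover have "(\<lambda>n. 2 * norm_sq (\<lambda>x. s n x - f x)) \<longlonglongrightarrow> 2 * 0"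
      using lim by (intro tendsto_mult_left)
    ultimately have "defect f \<le> 2 * 0" by (meson LIMSEQ_le_const)
    then show ?case using defect_nonneg[of f] lim by simp
  qed
qed

theorem parseval_frame:
  "parseval_frame_L2 \<mu> frame_index
     (\<lambda>(M, w) x. word_weight \<alpha> w * fourier_exp (word_frequency R w (c M)) x)"
  unfolding parseval_frame_L2_def
proof (intro conjI ballI)
  fix i assume "i \<in> frame_index"
  show "(case i of (M, w) \<Rightarrow> \<lambda>x. word_weight \<alpha> w * fourier_exp (word_frequency R w (c M)) x) \<in> L2_space \<mu>"
    by (cases i) (simp add: L2_scale)
next
  fix f assume f: "f \<in> L2_space \<mu>"
  have "(term_sq f has_sum energy f) frame_index"
    unfolding energy_def by (rule has_sum_infsum[OF term_sq_summable[OF f]])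
  also have "energy f = (L2_norm \<mu> f)\<^sup>2"
    using defect_zero[OF f] by (simp add: defect_def L2_norm_sq)
  also have "(term_sq f has_sum (L2_norm \<mu> f)\<^sup>2) frame_index \<longleftrightarrow>
      ((\<lambda>i. (cmod (L2_inner \<mu> f (case i of (M, w) \<Rightarrow>
         \<lambda>x. word_weight \<alpha> w * fourier_exp (word_frequency R w (c M)) x)))\<^sup>2)
        has_sum (L2_norm \<mu> f)\<^sup>2) frame_index"
  proof (rule has_sum_cong)
    fix i assume "i \<in> frame_index"
    then obtain M w where i: "i = (M, w)" "is_min_set M" by (auto simp: frame_index_def)
    show "term_sq f i = (cmod (L2_inner \<mu> f (case i of (M, w) \<Rightarrow>
         \<lambda>x. word_weight \<alpha> w * fourier_exp (word_frequency R w (c M)) x)))\<^sup>2"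
      using coeff_cuntz_word[OF f min_set_dual_point[OF i(2) choice[OF i(2)]]]
      by (simp add: i(1) term_sq_def)
  qed
  finally show "((\<lambda>i. (cmod (L2_inner \<mu> f (case i of (M, w) \<Rightarrow>
         \<lambda>x. word_weight \<alpha> w * fourier_exp (word_frequency R w (c M)) x)))\<^sup>2)
        has_sum (L2_norm \<mu> f)\<^sup>2) frame_index" .
qed

end

theorem theorem1p6:
  fixes R :: int and B L :: "int set" and \<mu> :: "real measure"
    and \<alpha> :: "int \<Rightarrow> complex" and c :: "real set \<Rightarrow> real"
  assumes "R \<ge> 2"
    and "finite B" and "0 \<in> B"
    and "self_affine_measure R B \<mu>"
    and "finite L" and "0 \<in> L"
    and "\<alpha> 0 = 1"
    and "orthonormal_columns L B (T_matrix R B \<alpha>)"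
    and "\<And>M. min_set R B L \<alpha> M \<Longrightarrow> c M \<in> M"
  shows "parseval_frame_L2 \<mu>
           (SIGMA M:{M. min_set R B L \<alpha> M}. Omega R B L \<alpha> (c M))
           (\<lambda>(M, w) x. word_weight \<alpha> w * fourier_exp (word_frequency R w (c M)) x)"
proof -
  interpret affine_frame_choice R B L \<mu> \<alpha> c
    by unfold_locales (use assms in auto)
  show ?thesis using parseval_frame unfolding frame_index_def .
qed

end
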